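(* Let $u_0\in L^1(\mathbb{R}^N)$ (of arbitrary sign) and let $u$ be a bounded weak solution of the Cauchy problem $\partial_t u+\mathcal{L}\varphi(u)=0$ in $\mathbb{R}^N\times(0,\infty)$, $u(\cdot,0)=u_0$. Let $m_c=\frac{(N-\sigma)_+}{N}$. If there is a constant $C>0$ such that $|\varphi(s)|\le C|s|^{m_c}$ for all $s$ (which for $m_c=0$ means $|\varphi(s)|\le C$), then $$\int_{\mathbb{R}^N}u(x,t)\,dx=\int_{\mathbb{R}^N}u_0(x)\,dx\qquad\text{for every }t>0.$$
   Context: Setting. $N\ge1$ is an integer, $\sigma\in(0,2)$, $\Lambda>0$, $Q=\mathbb{R}^N\times(0,\infty)$. The kernel $J$ is measurable and satisfies, for all $x\neq y$ and $z\ne0$ in $\mathbb{R}^N$: $J(x,y)=J(y,x)$; $J(x,x+z)=J(x,x-z)$; $\frac{1}{\Lambda|x-y|^{N+\sigma}}\le J(x,y)\le\frac{\Lambda}{|x-y|^{N+\sigma}}$. For smooth $f$, $\mathcal{L}f(x)=P.V.\int_{\mathbb{R}^N}(f(x)-f(y))J(x,y)\,dy$. The associated bilinear form is $\mathcal{E}(f,g)=\frac12\int_{\mathbb{R}^N}\int_{\mathbb{R}^N}(f(x)-f(y))(g(x)-g(y))J(x,y)\,dx\,dy$. Nonlinearity. $\varphi:\mathbb{R}\to\mathbb{R}$ is such that both $s\mapsto\varphi(s)$ and $s\mapsto-\varphi(-s)$, restricted to $[0,\infty)$, are in $C([0,\infty))\cap C^1((0,\infty))$, vanish at $0$, are strictly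 increasing, and have a power of exponent $1+A$ which is concave, for some $A>0$. Spaces. $[f]_{\dot H^{\sigma/2}(\mathbb{R}^N)}^2=\iint_{\mathbb{R}^N\times\mathbb{R}^N}\frac{(f(x)-f(y))^2}{|x-y|^{N+\sigma}}\,dx\,dy$, and $\dot H^{\sigma/2}(\mathbb{R}^N)$ is the corresponding homogeneous fractional Sobolev space (for $N>\sigma$: functions in $L^{2N/(N-\sigma)}(\mathbb{R}^N)$ with finite seminorm; for $N\le\sigma$: functions with finite seminorm, defined modulo constants). Weak solution. A weak solution of the Cauchy problem is a function $u\in C([0,\infty):L^1(\mathbb{R}^N))$ with $\varphi(u)\in L^2_{\rm loc}((0,\infty):\dot H^{\sigma/2}(\mathbb{R}^N))$, such that $\int_0^\infty\int_{\mathbb{R}^N}u\,\partial_t\zeta\,dx\,dt-\int_0^\infty\mathcal{E}(\varphi(u),\zeta)\,dt=0$ for every $\zeta\in C_c^\infty(Q)$, and $u(\cdot,0)=u_0$ a.e. Bounded means $u\in L^\infty(Q)$. *)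

theory Defs
  imports "HOL-Analysis.Analysis"
begin

text \<open>
  The space dimension $N$ is \<open>CARD('n)\<close>, and points of $\mathbb{R}^N$ have type \<open>real ^ 'n\<close>.
  Measurability is always Lebesgue measurability. A function of space and time is written
  \<open>u t x\<close>, with the time as first argument.
\<close>

definition space_time :: "((real ^ 'n) \<times> real) set" where
  "space_time = UNIV \<times> {0<..}"


subsection \<open>The kernel and the bilinear form\<close>

definition admissible_kernel ::
    "real \<Rightarrow> real \<Rightarrow> (real ^ 'n \<Rightarrow> real ^ 'n \<Rightarrow> real) \<Rightarrow> bool" where
  "admissible_kernel \<sigma> \<Lambda> J \<longleftrightarrow>
     (\<lambda>(x, y). J x y) \<in> borel_measurable lebesgue \<and>
     (\<forall>x y. x \<noteq> y \<longrightarrow> J x y = J y x) \<and>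
     (\<forall>x z. z \<noteq> 0 \<longrightarrow> J x (x + z) = J x (x - z)) \<and>
     (\<forall>x y. x \<noteq> y \<longrightarrow>
        1 / (\<Lambda> * norm (x - y) powr (real CARD('n) + \<sigma>)) \<le> J x y \<and>
        J x y \<le> \<Lambda> / norm (x - y) powr (real CARD('n) + \<sigma>))"

definition bilinear_form ::
    "(real ^ 'n \<Rightarrow> real ^ 'n \<Rightarrow> real) \<Rightarrow> (real ^ 'n \<Rightarrow> real) \<Rightarrow> (real ^ 'n \<Rightarrow> real) \<Rightarrow> real" where
  "bilinear_form J f g =
     1 / 2 * (LINT (x, y)|lebesgue. (f x - f y) * (g x - g y) * J x y)"


subsection \<open>The nonlinearity\<close>

definition nonlinearity_class :: "(real \<Rightarrow> real) \<Rightarrow> bool" where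
  "nonlinearity_class g \<longleftrightarrow>
     continuous_on {0..} g \<and> g C1_differentiable_on {0<..} \<and>
     g 0 = 0 \<and> strict_mono_on {0..} g \<and>
     (\<exists>A>0. concave_on {0..} (\<lambda>s. g s powr (1 + A)))"

definition admissible_nonlinearity :: "(real \<Rightarrow> real) \<Rightarrow> bool" where
  "admissible_nonlinearity \<phi> \<longleftrightarrow>
     nonlinearity_class \<phi> \<and> nonlinearity_class (\<lambda>s. - \<phi> (- s))"


subsection \<open>Function spaces\<close>

definition Hdot_seminorm_sq :: "real \<Rightarrow> (real ^ 'n \<Rightarrow> real) \<Rightarrow> ennreal" where
  "Hdot_seminorm_sq \<sigma> f =
     (\<integral>\<^sup>+ (x, y). ennreal ((f x - f y)\<^sup>2 / norm (x - y) powr (real CARD('n) + \<sigma>)) \<partial>lebesgue)"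

text \<open>
  The space $\dot H^{\sigma/2}(\mathbb{R}^N)$. For $N \le \sigma$ its elements are classes modulo
  constants; the predicate then holds of a function iff it represents such a class, and
  \<open>Hdot_seminorm_sq\<close> and \<open>bilinear_form\<close> do not depend on the representative.
\<close>

definition in_Hdot :: "real \<Rightarrow> (real ^ 'n \<Rightarrow> real) \<Rightarrow> bool" where
  "in_Hdot \<sigma> f \<longleftrightarrow>
     f \<in> borel_measurable lebesgue \<and> Hdot_seminorm_sq \<sigma> f < \<infinity> \<and>
     (real CARD('n) > \<sigma> \<longrightarrow>
        integrable lebesgue
          (\<lambda>x. \<bar>f x\<bar> powr (2 * real CARD('n) / (real CARD('n) - \<sigma>))))"

text \<open>
  $L^2_{\rm loc}((0,\infty) : \dot H^{\sigma/2}(\mathbb{R}^N))$. Since $\dot H^{\sigma/2}$ is a separable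
  Hilbert space, a jointly measurable \<open>v\<close> with \<open>v t\<close> in it for almost every \<open>t\<close> is strongly
  measurable as a map of \<open>t\<close>, by Pettis' theorem.
\<close>

definition L2_loc_Hdot :: "real \<Rightarrow> (real \<Rightarrow> real ^ 'n \<Rightarrow> real) \<Rightarrow> bool" where
  "L2_loc_Hdot \<sigma> v \<longleftrightarrow>
     (\<lambda>(x, t). v t x) \<in> borel_measurable (lebesgue_on space_time) \<and>
     (AE t in lebesgue_on {0<..}. in_Hdot \<sigma> (v t)) \<and>
     (\<forall>a b. 0 < a \<and> a < b \<longrightarrow>
        (\<integral>\<^sup>+ t \<in> {a..b}. Hdot_seminorm_sq \<sigma> (v t) \<partial>lebesgue) < \<infinity>)"

definition continuous_L1 :: "(real \<Rightarrow> real ^ 'n \<Rightarrow> real) \<Rightarrow> bool" where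
  "continuous_L1 u \<longleftrightarrow>
     (\<forall>t\<ge>0. integrable lebesgue (u t)) \<and>
     (\<forall>s\<ge>0. ((\<lambda>t. LINT x|lebesgue. \<bar>u t x - u s x\<bar>) \<longlongrightarrow> 0) (at s within {0..}))"

definition bounded_on_space_time :: "(real \<Rightarrow> real ^ 'n \<Rightarrow> real) \<Rightarrow> bool" where
  "bounded_on_space_time u \<longleftrightarrow>
     (\<lambda>(x, t). u t x) \<in> borel_measurable (lebesgue_on space_time) \<and>
     (\<exists>M. AE (x, t) in lebesgue_on space_time. \<bar>u t x\<bar> \<le> M)"


subsection \<open>Test functions\<close>

primrec Ck :: "nat \<Rightarrow> ('a::euclidean_space \<Rightarrow> real) \<Rightarrow> bool" where
  "Ck 0 f \<longleftrightarrow> continuous_on UNIV f"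
| "Ck (Suc k) f \<longleftrightarrow>
     (\<forall>x. f differentiable (at x)) \<and> (\<forall>v. Ck k (\<lambda>x. frechet_derivative f (at x) v))"

text \<open>Elements of $C_c^\infty(Q)$ are taken to be extended by zero to $t \le 0$.\<close>

definition test_function :: "((real ^ 'n) \<times> real \<Rightarrow> real) \<Rightarrow> bool" where
  "test_function \<zeta> \<longleftrightarrow>
     (\<forall>k. Ck k \<zeta>) \<and>
     compact (closure {p. \<zeta> p \<noteq> 0}) \<and> closure {p. \<zeta> p \<noteq> 0} \<subseteq> space_time"


subsection \<open>Weak solutions\<close>

definition weak_solution ::
    "real \<Rightarrow> (real ^ 'n \<Rightarrow> real ^ 'n \<Rightarrow> real) \<Rightarrow> (real \<Rightarrow> real) \<Rightarrow> (real ^ 'n \<Rightarrow> real) \<Rightarrow>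
     (real \<Rightarrow> real ^ 'n \<Rightarrow> real) \<Rightarrow> bool" where
  "weak_solution \<sigma> J \<phi> u0 u \<longleftrightarrow>
     continuous_L1 u \<and>
     L2_loc_Hdot \<sigma> (\<lambda>t x. \<phi> (u t x)) \<and>
     (\<forall>\<zeta>. test_function \<zeta> \<longrightarrow>
        (LINT t:{0<..}|lebesgue. LINT x|lebesgue. u t x * deriv (\<lambda>s. \<zeta> (x, s)) t)
        - (LINT t:{0<..}|lebesgue. bilinear_form J (\<lambda>x. \<phi> (u t x)) (\<lambda>x. \<zeta> (x, t))) = 0) \<and>
     (AE x in lebesgue. u 0 x = u0 x)"

definition critical_exponent :: "'n::finite itself \<Rightarrow> real \<Rightarrow> real" where
  "critical_exponent _ \<sigma> = max 0 (real CARD('n) - \<sigma>) / real CARD('n)"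

end

theory Submission
  imports Defs "HOL-Computational_Algebra.Polynomial"
begin

text \<open>
  Mass is conserved because testing the equation with a cutoff \<open>bump (x / R)\<close> times a function
  \<open>\<eta>\<close> of time leaves, besides the time derivative of the mass seen through the cutoff, only
  the term \<open>\<E> (\<phi> u, bump (\<cdot> / R))\<close>, and this term tends to zero as \<open>R\<close> grows.

  To see the latter, write \<open>N\<close> for the dimension, \<open>v = \<phi> u\<close> and \<open>g = bump (\<cdot> / R)\<close>. The symmetry
  of the kernel moves the whole difference onto \<open>g\<close>, and the reflection symmetry
  \<open>J x (x + z) = J x (x - z)\<close> turns it into the second difference
  \<open>2 g x - g (x + z) - g (x - z)\<close>. No principal value is needed if the form is first truncated to
  \<open>\<bar>x - y\<bar> > \<epsilon>\<close>: the bound obtained does not depend on \<open>\<epsilon>\<close>, and truncation is removed by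
  dominated convergence (\<open>truncated_form_bound\<close>, \<open>bilinear_form_bound\<close>). The second difference is
  at most a constant times \<open>min 1 ((\<bar>z\<bar> / R)\<^sup>2)\<close> and vanishes unless one of \<open>x\<close>, \<open>x + z\<close>, \<open>x - z\<close> lies
  in the ball of radius \<open>R\<close>. Since \<open>min 1 ((\<bar>z\<bar> / R)\<^sup>2) \<bar>z\<bar> powr (-(N + \<sigma>))\<close> has integral
  of order \<open>R powr (-\<sigma>)\<close>, a function with \<open>\<bar>v\<bar> \<le> a + q\<close> satisfies
  \<open>\<bar>\<E> (v, g)\<bar> \<le> D R powr (-\<sigma>) (a R ^ N + \<integral> q)\<close> (\<open>bilinear_form_bump_bound\<close>).

  The growth condition enters in the form: for every \<open>\<epsilon> > 0\<close> there is \<open>K\<close> with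
  \<open>R powr (-\<sigma>) \<bar>\<phi> s\<bar> \<le> \<epsilon> R powr (-N) + K \<bar>s\<bar>\<close> for all \<open>R \<ge> 1\<close> and all \<open>s\<close>
  (\<open>nonlinearity_growth\<close>). The critical exponent is the smallest one for which \<open>K\<close> can be chosen
  independently of \<open>R\<close>. With \<open>a\<close> coming from the first summand and \<open>q\<close> from the
  positive part of \<open>R powr (-\<sigma>) \<bar>v\<bar> - \<epsilon> R powr (-N)\<close>, which tends to zero pointwise and is
  dominated by \<open>K \<bar>u\<bar>\<close>, the form is at most \<open>D (\<epsilon> + o(1))\<close> (\<open>forms_tendsto_zero\<close>).

  Passing to the limit \<open>R \<rightarrow> \<infinity>\<close> gives \<open>\<integral> \<eta>' M = 0\<close> for the mass \<open>M\<close>. Choosing \<open>\<eta>'\<close> as the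
  difference of two narrow bumps around \<open>a\<close> and \<open>b\<close> yields \<open>M a = M b\<close>
  (\<open>continuous_eq_from_mollified\<close>), and continuity of \<open>M\<close> at \<open>0\<close> identifies the constant.
\<close>

section \<open>Smooth functions\<close>

lemma differentiable_imp_continuous_UNIV:
  fixes f :: "'a::euclidean_space \<Rightarrow> real"
  assumes "\<forall>x. f differentiable (at x)"
  shows "continuous_on UNIV f"
  using assms by (simp add: continuous_at_imp_continuous_on differentiable_imp_continuous_within)

lemma Ck_SucI:
  fixes f :: "'a::euclidean_space \<Rightarrow> real"
  assumes "\<And>x. (f has_derivative f' x) (at x)" "\<And>v. Ck k (\<lambda>x. f' x v)"
  shows "Ck (Suc k) f"
proof -
  have "frechet_derivative f (at x) = f' x" for x
    using frechet_derivative_at[OF assms(1)] by simp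
  then show ?thesis using assms by (auto simp: differentiable_def)
qed

lemma Ck_SucD:
  fixes f :: "'a::euclidean_space \<Rightarrow> real"
  assumes "Ck (Suc k) f"
  shows "(f has_derivative frechet_derivative f (at x)) (at x)"
    and "Ck k (\<lambda>x. frechet_derivative f (at x) v)"
  using assms by (auto simp: frechet_derivative_works[symmetric])

lemma Ck_mono: "Ck (Suc k) f \<Longrightarrow> Ck k f"
proof (induction k arbitrary: f)
  case 0
  then show ?case by (simp add: differentiable_imp_continuous_UNIV)
next
  case (Suc k)
  from Suc.prems have "\<forall>x. f differentiable (at x)" "\<And>v. Ck (Suc k) (\<lambda>x. frechet_derivative f (at x) v)"
    by simp_all
  then show ?case using Suc.IH by simp
qed

lemma Ck_const: "Ck k (\<lambda>x. c)"
proof (induction k arbitrary: c)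
  case (Suc k)
  show ?case by (rule Ck_SucI[where f' = "\<lambda>x v. 0"]) (auto intro: Suc)
qed simp

lemma Ck_bounded_linear: "bounded_linear f \<Longrightarrow> Ck k f"
proof (cases k)
  case 0
  assume "bounded_linear f" with 0 show ?thesis by (simp add: linear_continuous_on)
next
  case (Suc j)
  assume "bounded_linear f"
  with Suc show ?thesis
    by (auto intro!: Ck_SucI[where f' = "\<lambda>x. f"] bounded_linear_imp_has_derivative Ck_const
        simp del: Ck.simps)
qed

lemma Ck_add: "Ck k f \<Longrightarrow> Ck k g \<Longrightarrow> Ck k (\<lambda>x. f x + g x)"
proof (induction k arbitrary: f g)
  case 0
  then show ?case by (simp add: continuous_on_add)
next
  case (Suc k)
  note D = Ck_SucD[OF Suc.prems(1)] Ck_SucD[OF Suc.prems(2)]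
  show ?case
    by (rule Ck_SucI[OF has_derivative_add[OF D(1) D(3)]]) (intro Suc.IH D)
qed

lemma Ck_mult: "Ck k f \<Longrightarrow> Ck k g \<Longrightarrow> Ck k (\<lambda>x. f x * g x)"
proof (induction k arbitrary: f g)
  case 0
  then show ?case by (simp add: continuous_on_mult)
next
  case (Suc k)
  note D = Ck_SucD[OF Suc.prems(1)] Ck_SucD[OF Suc.prems(2)]
  show ?case
    by (rule Ck_SucI[OF has_derivative_mult[OF D(1) D(3)]])
       (intro Suc.IH Ck_add D Ck_mono[OF Suc.prems(1)] Ck_mono[OF Suc.prems(2)])
qed

lemma Ck_affine_comp:
  fixes f :: "'a::euclidean_space \<Rightarrow> real" and L :: "'b::euclidean_space \<Rightarrow> 'a"
  assumes L: "bounded_linear L"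
  shows "Ck k f \<Longrightarrow> Ck k (\<lambda>x. f (L x + c))"
proof (induction k arbitrary: f)
  case 0
  then have "continuous_on UNIV f" by simp
  then have "continuous_on UNIV (f \<circ> (\<lambda>x. L x + c))"
    by (intro continuous_on_compose continuous_intros linear_continuous_on[OF L])
       (auto intro: continuous_on_subset)
  then show ?case by (simp add: o_def)
next
  case (Suc k)
  note D = Ck_SucD[OF Suc.prems]
  have "((\<lambda>x. L x + c) has_derivative L) (at x)" for x
    using bounded_linear_imp_has_derivative[OF L] by (auto intro!: derivative_eq_intros)
  from has_derivative_compose[OF this D(1)]
  have "((\<lambda>x. f (L x + c)) has_derivative (\<lambda>v. frechet_derivative f (at (L x + c)) (L v))) (at x)" for x .
  then show ?case by (rule Ck_SucI) (rule Suc.IH[OF D(2)])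
qed

lemma Ck_compose_real:
  fixes f :: "'a::euclidean_space \<Rightarrow> real" and g :: "real \<Rightarrow> real"
  shows "Ck k f \<Longrightarrow> Ck k g \<Longrightarrow> Ck k (\<lambda>x. g (f x))"
proof (induction k arbitrary: g)
  case 0
  then show ?case using continuous_on_compose2[of UNIV g UNIV f] by simp
next
  case (Suc k)
  note D = Ck_SucD[OF Suc.prems(1)] Ck_SucD[OF Suc.prems(2)]
  have lin: "frechet_derivative g (at y) v = v * frechet_derivative g (at y) 1" for y v
    using linear_scale[OF has_derivative_linear[OF D(3)[of y]], of v 1] by simp
  have d: "((\<lambda>x. g (f x)) has_derivative
      (\<lambda>v. frechet_derivative f (at x) v * frechet_derivative g (at (f x)) 1)) (at x)" for x
    using has_derivative_compose[OF D(1) D(3)] by (subst (asm) lin)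
  have "Ck k (\<lambda>x. frechet_derivative g (at (f x)) 1)"
    by (rule Suc.IH[OF Ck_mono[OF Suc.prems(1)] D(4)])
  then show ?case
    by (intro Ck_SucI[OF d] Ck_mult D(2))
qed

lemma Ck_real_SucI:
  fixes f :: "real \<Rightarrow> real"
  assumes "\<And>x. (f has_real_derivative f' x) (at x)" "Ck k f'"
  shows "Ck (Suc k) f"
proof (rule Ck_SucI)
  show "(f has_derivative (\<lambda>v. f' x * v)) (at x)" for x
    using assms(1)[of x] by (simp add: has_field_derivative_def)
  show "Ck k (\<lambda>x. f' x * v)" for v
    by (rule Ck_mult[OF assms(2) Ck_const])
qed

text \<open>
The functions \<open>flat p\<close> form a family closed under differentiation that contains the classical flat
function \<open>exp (- 1 / s)\<close>. Carrying the polynomial factor along makes smoothness a one-line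
induction.
\<close>

definition flat :: "real poly \<Rightarrow> real \<Rightarrow> real" where
  "flat p s = (if s > 0 then poly p (1 / s) * exp (- (1 / s)) else 0)"

lemma poly_mult_exp_tendsto_0: "((\<lambda>x::real. poly p x * exp (- x)) \<longlongrightarrow> 0) at_top"
proof -
  have "((\<lambda>x::real. \<Sum>i\<le>degree p. coeff p i * (x ^ i / exp x)) \<longlongrightarrow> (\<Sum>i\<le>degree p. coeff p i * 0)) at_top"
    by (intro tendsto_intros tendsto_power_div_exp_0)
  then show ?thesis
    by (simp add: poly_altdef sum_distrib_right exp_minus divide_inverse mult.assoc)
qed

lemma flat_has_derivative:
  "(flat p has_real_derivative flat ([:0, 0, 1:] * (p - pderiv p)) s) (at s)"
proof (cases "s = 0")
  case False
  show ?thesis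
  proof (cases "s > 0")
    case True
    have "((\<lambda>s. poly p (1 / s) * exp (- (1 / s))) has_real_derivative
        flat ([:0, 0, 1:] * (p - pderiv p)) s) (at s)"
      using True
      by (auto intro!: derivative_eq_intros DERIV_chain'[OF _ poly_DERIV]
          simp: flat_def field_simps power2_eq_square)
    then show ?thesis
      by (rule has_field_derivative_transform_within_open[where S = "{0<..}"])
         (use True in \<open>auto simp: flat_def\<close>)
  next
    case f: False
    with False have "s < 0" by simp
    have "((\<lambda>s. 0) has_real_derivative flat ([:0, 0, 1:] * (p - pderiv p)) s) (at s)"
      using f by (simp add: flat_def)
    then show ?thesis
      by (rule has_field_derivative_transform_within_open[where S = "{..<0}"])
         (use \<open>s < 0\<close> in \<open>auto simp: flat_def\<close>)
  qed
next
  case True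
  \<comment> \<open>At the origin the difference quotient is the polynomial times one more factor \<open>1 / s\<close>, still beaten by the exponential.\<close>
  have "((\<lambda>x. poly ([:0, 1:] * p) (inverse x) * exp (- inverse x)) \<longlongrightarrow> 0) (at_right (0::real))"
    by (rule filterlim_compose[OF poly_mult_exp_tendsto_0 filterlim_inverse_at_top_right])
  then have r: "((\<lambda>y. (flat p y - flat p 0) / (y - 0)) \<longlongrightarrow> 0) (at_right 0)"
    by (rule Lim_transform_eventually)
       (auto simp: eventually_at_filter flat_def divide_inverse mult_ac)
  have l: "((\<lambda>y. (flat p y - flat p 0) / (y - 0)) \<longlongrightarrow> 0) (at_left 0)"
    by (rule Lim_transform_eventually[OF tendsto_const])
       (auto simp: eventually_at_filter flat_def)
  show ?thesis
    using filterlim_split_at[OF l r] True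
    by (simp add: has_field_derivative_iff) (simp add: flat_def)
qed

lemma Ck_flat: "Ck k (flat p)"
proof (induction k arbitrary: p)
  case 0
  show ?case
    using flat_has_derivative by (auto intro: DERIV_continuous_on has_field_derivative_at_within)
next
  case (Suc k)
  show ?case by (rule Ck_real_SucI[OF flat_has_derivative Suc])
qed

text \<open>
The factor \<open>exp 1\<close> normalises the value at the origin to 1. No plateau is required: it is enough
that \<open>bump (x / R)\<close> tends to 1 pointwise as \<open>R\<close> grows.
\<close>

definition bump :: "'a::euclidean_space \<Rightarrow> real" where
  "bump x = exp 1 * flat 1 (1 - (norm x)\<^sup>2)"

lemma Ck_norm_squared: "Ck k (\<lambda>x::'a::euclidean_space. (norm x)\<^sup>2)"
proof (cases k)
  case 0
  then show ?thesis by (auto intro!: continuous_intros)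
next
  case (Suc j)
  have "((\<lambda>x::'a. (norm x)\<^sup>2) has_derivative (\<lambda>v. 2 * (x \<bullet> v))) (at x)" for x
    unfolding power2_norm_eq_inner
    by (auto intro!: derivative_eq_intros simp: inner_commute)
  moreover have "Ck j (\<lambda>x::'a. 2 * (x \<bullet> v))" for v
    by (intro Ck_bounded_linear bounded_linear_const_mult bounded_linear_inner_left)
  ultimately show ?thesis unfolding Suc by (rule Ck_SucI)
qed

lemma Ck_bump: "Ck k (bump :: 'a::euclidean_space \<Rightarrow> real)"
proof -
  have "Ck k (\<lambda>x::'a. 1 + (-1) * (norm x)\<^sup>2)"
    by (intro Ck_add Ck_mult Ck_const Ck_norm_squared)
  then have "Ck k (\<lambda>x::'a. exp 1 * flat 1 (1 + (-1) * (norm x)\<^sup>2))"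
    by (intro Ck_mult Ck_const Ck_compose_real[OF _ Ck_flat])
  moreover have "(\<lambda>x::'a. exp 1 * flat 1 (1 + (-1) * (norm x)\<^sup>2)) = bump"
    by (rule ext) (simp add: bump_def)
  ultimately show ?thesis by (rule back_subst)
qed

lemma continuous_bump: "continuous_on S (bump :: 'a::euclidean_space \<Rightarrow> real)"
  using Ck_bump[of 0] by (auto intro: continuous_on_subset)

lemma bump_measurable [measurable]: "bump \<in> borel_measurable borel"
  by (intro borel_measurable_continuous_onI continuous_bump)

lemma bump_0: "bump 0 = 1"
  by (simp add: bump_def flat_def flip: exp_add)

lemma bump_nonneg: "0 \<le> bump x"
  by (simp add: bump_def flat_def)

lemma bump_le_1: "bump x \<le> 1"
proof (cases "norm x < 1")
  case True
  then have "0 < 1 - (norm x)\<^sup>2" "1 - (norm x)\<^sup>2 \<le> 1" by (simp_all add: abs_square_less_1)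
  then have "1 \<le> 1 / (1 - (norm x)\<^sup>2)" by (simp add: field_simps)
  then show ?thesis using \<open>0 < 1 - (norm x)\<^sup>2\<close>
    by (simp add: bump_def flat_def flip: exp_add)
next
  case False
  then have "1 \<le> (norm x)\<^sup>2" by (simp add: one_le_power)
  then show ?thesis by (simp add: bump_def flat_def)
qed

lemma bump_eq_0_iff: "bump x = 0 \<longleftrightarrow> 1 \<le> norm x"
  using abs_square_less_1[of "norm x"] by (auto simp: bump_def flat_def)

lemma second_difference_bound:
  fixes f f' f'' :: "real \<Rightarrow> real"
  assumes "\<And>s. (f has_real_derivative f' s) (at s)" "\<And>s. (f' has_real_derivative f'' s) (at s)"
    and "\<And>s. \<bar>f'' s\<bar> \<le> C"
  shows "\<bar>f 1 + f (-1) - 2 * f 0\<bar> \<le> C"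
proof -
  let ?k = "\<lambda>s. f s - f (s - 1)"
  have k: "(?k has_real_derivative (f' s - f' (s - 1))) (at s)" for s
    by (auto intro!: derivative_eq_intros DERIV_chain'[OF _ assms(1)] assms(1))
  obtain x where x: "?k 1 - ?k 0 = (1 - 0) * (f' x - f' (x - 1))"
    using MVT2[of 0 1 ?k "\<lambda>s. f' s - f' (s - 1)"] k by auto
  obtain y where y: "f' x - f' (x - 1) = (x - (x - 1)) * f'' y"
    using MVT2[of "x - 1" x f' f''] assms(2) by auto
  have "f 1 + f (-1) - 2 * f 0 = f'' y" using x y by simp
  then show ?thesis using assms(3) by simp
qed

lemma bounded_flat:
  shows "\<exists>K. \<forall>s\<le>1. \<bar>flat p s\<bar> \<le> K"
proof -
  have "compact (flat p ` {0..1})"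
    using Ck_flat[of 0 p] by (intro compact_continuous_image) (auto intro: continuous_on_subset)
  then obtain K where K: "\<And>s. s \<in> {0..1} \<Longrightarrow> \<bar>flat p s\<bar> \<le> K"
    by (metis compact_imp_bounded bounded_iff image_eqI real_norm_def)
  have "\<bar>flat p s\<bar> \<le> K" if "s \<le> 1" for s
    using K[of s] K[of 0] that by (cases "s \<ge> 0") (auto simp: flat_def)
  then show ?thesis by blast
qed

text \<open>
Along the line through \<open>x\<close> in direction \<open>z\<close> the bump is \<open>exp 1 * flat 1 (q s)\<close> with a quadratic
polynomial \<open>q \<le> 1\<close>. Its second derivative is of order \<open>(norm z)\<^sup>2\<close>: the first derivative of \<open>q\<close> is
bounded by \<open>2 * norm z\<close> inside the unit ball, and outside of it all derivatives of \<open>flat\<close> vanish.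
\<close>

lemma bump_second_difference:
  "\<exists>C>0. \<forall>x z::'a::euclidean_space. \<bar>2 * bump x - bump (x + z) - bump (x - z)\<bar> \<le> C * min 1 ((norm z)\<^sup>2)"
proof -
  obtain p1 where p1: "\<And>s. (flat 1 has_real_derivative flat p1 s) (at s)"
    using flat_has_derivative by blast
  obtain p2 where p2: "\<And>s. (flat p1 has_real_derivative flat p2 s) (at s)"
    using flat_has_derivative by blast
  obtain K1 where K1: "\<And>s. s \<le> 1 \<Longrightarrow> \<bar>flat p1 s\<bar> \<le> K1" using bounded_flat by blast
  obtain K2 where K2: "\<And>s. s \<le> 1 \<Longrightarrow> \<bar>flat p2 s\<bar> \<le> K2" using bounded_flat by blast
  have K0: "0 \<le> K1" "0 \<le> K2"
    using K1[of 0] K2[of 0] abs_ge_zero[of "flat p1 0"] abs_ge_zero[of "flat p2 0"] by linarith+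
  define C where "C = exp 1 * (4 * K2 + 2 * K1) + 4"
  have quad: "\<bar>2 * bump x - bump (x + z) - bump (x - z)\<bar> \<le> exp 1 * (4 * K2 + 2 * K1) * (norm z)\<^sup>2"
    for x z :: 'a
  proof -
    define q where "q s = 1 - (norm (x + s *\<^sub>R z))\<^sup>2" for s
    define q' where "q' s = - 2 * ((x + s *\<^sub>R z) \<bullet> z)" for s
    have q: "(q has_real_derivative q' s) (at s)" for s
      unfolding q_def q'_def power2_norm_eq_inner
      unfolding has_field_derivative_def
      by (auto intro!: derivative_eq_intros simp: algebra_simps inner_commute)
    have q'': "(q' has_real_derivative (- 2 * (norm z)\<^sup>2)) (at s)" for s
      unfolding q'_def power2_norm_eq_inner
      unfolding has_field_derivative_def
      by (auto intro!: derivative_eq_intros simp: algebra_simps inner_commute)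
    let ?f = "\<lambda>s. exp 1 * flat 1 (q s)"
    let ?f' = "\<lambda>s. exp 1 * (flat p1 (q s) * q' s)"
    let ?f'' = "\<lambda>s. exp 1 * (flat p2 (q s) * q' s * q' s + flat p1 (q s) * (- 2 * (norm z)\<^sup>2))"
    have 1: "(?f has_real_derivative ?f' s) (at s)" for s
      by (intro DERIV_cmult DERIV_chain2[OF p1 q])
    have 2: "(?f' has_real_derivative ?f'' s) (at s)" for s
    proof (rule DERIV_cmult)
      show "((\<lambda>s. flat p1 (q s) * q' s) has_real_derivative
          flat p2 (q s) * q' s * q' s + flat p1 (q s) * (- 2 * (norm z)\<^sup>2)) (at s)"
        using DERIV_mult'[OF DERIV_chain2[OF p2 q] q''] by (simp only: add.commute)
    qed
    have q1: "q s \<le> 1" for s by (simp add: q_def)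
    have 3: "\<bar>?f'' s\<bar> \<le> exp 1 * (4 * K2 + 2 * K1) * (norm z)\<^sup>2" for s
    proof -
      have a: "\<bar>flat p2 (q s) * q' s * q' s\<bar> \<le> K2 * (4 * (norm z)\<^sup>2)"
      proof (cases "q s > 0")
        case True
        then have "norm (x + s *\<^sub>R z) \<le> 1"
          using power2_le_imp_le[of "norm (x + s *\<^sub>R z)" 1] by (simp add: q_def)
        moreover have "\<bar>(x + s *\<^sub>R z) \<bullet> z\<bar> \<le> norm (x + s *\<^sub>R z) * norm z"
          by (rule Cauchy_Schwarz_ineq2)
        ultimately have "\<bar>(x + s *\<^sub>R z) \<bullet> z\<bar> \<le> norm z"
          by (meson mult_left_le_one_le norm_ge_zero order_trans)
        then have "\<bar>q' s\<bar> \<le> 2 * norm z" by (simp add: q'_def abs_mult)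
        then have "\<bar>q' s\<bar> * \<bar>q' s\<bar> \<le> (2 * norm z) * (2 * norm z)"
          by (intro mult_mono) auto
        then have "\<bar>q' s\<bar> * \<bar>q' s\<bar> \<le> 4 * (norm z)\<^sup>2" by (simp add: power2_eq_square)
        from mult_mono[OF K2[OF q1[of s]] this]
        have "\<bar>flat p2 (q s)\<bar> * (\<bar>q' s\<bar> * \<bar>q' s\<bar>) \<le> K2 * (4 * (norm z)\<^sup>2)"
          using K0 by simp
        then show ?thesis by (simp add: abs_mult mult.assoc)
      next
        case False
        then show ?thesis using K0 by (simp add: flat_def)
      qed
      have b: "\<bar>flat p1 (q s) * (- 2 * (norm z)\<^sup>2)\<bar> \<le> K1 * (2 * (norm z)\<^sup>2)"
        using mult_mono[OF K1[OF q1[of s]] order_refl[of "2 * (norm z)\<^sup>2"]] K0 by (simp add: abs_mult)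
      have "\<bar>flat p2 (q s) * q' s * q' s + flat p1 (q s) * (- 2 * (norm z)\<^sup>2)\<bar>
          \<le> K2 * (4 * (norm z)\<^sup>2) + K1 * (2 * (norm z)\<^sup>2)"
        using a b by linarith
      from mult_left_mono[OF this, of "exp 1"] show ?thesis
        unfolding abs_mult[of "exp 1"] abs_exp_cancel by (simp only: algebra_simps exp_ge_zero)
    qed
    have "?f s = bump (x + s *\<^sub>R z)" for s by (simp add: bump_def q_def)
    with second_difference_bound[of ?f ?f' ?f'', OF 1 2 3] show ?thesis by simp
  qed
  have "\<bar>2 * bump x - bump (x + z) - bump (x - z)\<bar> \<le> C * min 1 ((norm z)\<^sup>2)" for x z :: 'a
  proof (cases "norm z \<le> 1")
    case True
    then have m: "min 1 ((norm z)\<^sup>2) = (norm z)\<^sup>2" by (intro min_absorb2 power_le_one) auto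
    have "exp 1 * (4 * K2 + 2 * K1) * (norm z)\<^sup>2 \<le> C * (norm z)\<^sup>2"
      by (intro mult_right_mono) (simp_all add: C_def)
    with quad[of x z] show ?thesis unfolding m by (rule order_trans)
  next
    case False
    then have "min 1 ((norm z)\<^sup>2) = 1" by (intro min_absorb1 one_le_power) auto
    moreover have "\<bar>2 * bump x - bump (x + z) - bump (x - z)\<bar> \<le> 4"
      using bump_nonneg[of x] bump_nonneg[of "x + z"] bump_nonneg[of "x - z"]
        bump_le_1[of x] bump_le_1[of "x + z"] bump_le_1[of "x - z"] by linarith
    moreover have "0 \<le> exp 1 * (4 * K2 + 2 * K1)" using K0 by simp
    ultimately show ?thesis by (simp add: C_def)
  qed
  moreover have "C > 0" using K0 by (simp add: C_def add_nonneg_pos)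
  ultimately show ?thesis by blast
qed

section \<open>Lebesgue measurable functions on a product\<close>

text \<open>
Borel measurability of \<open>T\<close> does not make \<open>f \<circ> T\<close> Lebesgue measurable for Lebesgue measurable
\<open>f\<close>; this needs that preimages of null sets are null. It holds for projections and for
measure-preserving maps, the only substitutions made below.
\<close>

lemma lebesgue_measurable_if_null:
  fixes T :: "'a::euclidean_space \<Rightarrow> 'b::euclidean_space"
  assumes [measurable]: "T \<in> borel \<rightarrow>\<^sub>M borel"
    and null: "\<And>N. N \<in> null_sets lborel \<Longrightarrow> T -` N \<in> null_sets lborel"
  shows "T \<in> lebesgue \<rightarrow>\<^sub>M lebesgue"
    and "(AE x in lborel. P x) \<Longrightarrow> (AE x in lborel. P (T x))"
proof -
  have T: "T \<in> lebesgue \<rightarrow>\<^sub>M lborel" by (simp add: measurable_completion)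
  have "null_sets lborel \<subseteq> null_sets (distr lebesgue lborel T)"
  proof
    fix N :: "'b set" assume N: "N \<in> null_sets lborel"
    then have "T -` N \<in> null_sets lebesgue" using null by (intro null_sets_completionI) auto
    then show "N \<in> null_sets (distr lebesgue lborel T)"
      using N T by (auto simp: null_sets_def emeasure_distr)
  qed
  then show "T \<in> lebesgue \<rightarrow>\<^sub>M lebesgue" by (rule completion.measurable_completion2[OF T])
  assume "AE x in lborel. P x"
  then obtain N where N: "N \<in> null_sets lborel" "{x. \<not> P x} \<subseteq> N"
    unfolding eventually_ae_filter by auto
  then show "AE x in lborel. P (T x)"
    by (intro AE_I'[OF null[OF N(1)]]) auto
qed

lemma fst_vimage_null:
  fixes N :: "'a::euclidean_space set"
  assumes "N \<in> null_sets lborel"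
  shows "fst -` N \<in> null_sets (lborel :: ('a \<times> 'b::euclidean_space) measure)"
proof -
  have "N \<times> UNIV \<in> null_sets (lborel \<Otimes>\<^sub>M (lborel :: 'b measure))"
    using assms by (intro lborel.times_in_null_sets1) auto
  moreover have "fst -` N = N \<times> (UNIV :: 'b set)" by auto
  ultimately show ?thesis by (simp add: lborel_prod)
qed

lemma measure_preserving_vimage_null:
  fixes T :: "'a::euclidean_space \<Rightarrow> 'a"
  assumes [measurable]: "T \<in> borel \<rightarrow>\<^sub>M borel" and T: "distr lborel borel T = lborel"
    and "N \<in> null_sets lborel"
  shows "T -` N \<in> null_sets lborel"
proof -
  have "emeasure (distr lborel borel T) N = emeasure lborel (T -` N)"
    using assms(3) by (subst emeasure_distr) auto
  then show ?thesis
    using assms(3) T measurable_sets[OF assms(1), of N] by (auto simp: null_sets_def)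
qed

lemma measure_preserving_lebesgue:
  fixes T :: "'a::euclidean_space \<Rightarrow> 'a" and f :: "'a \<Rightarrow> real"
  assumes T: "T \<in> borel \<rightarrow>\<^sub>M borel" "distr lborel borel T = lborel"
    and f: "f \<in> borel_measurable lebesgue"
  shows "integrable lebesgue (\<lambda>x. f (T x)) \<longleftrightarrow> integrable lebesgue f"
    and "(LINT x|lebesgue. f (T x)) = (LINT x|lebesgue. f x)"
proof -
  note null = measure_preserving_vimage_null[OF T]
  have TL: "T \<in> lebesgue \<rightarrow>\<^sub>M lebesgue"
    by (rule lebesgue_measurable_if_null[OF T(1) null])
  have TB: "T \<in> lebesgue \<rightarrow>\<^sub>M lborel" using T(1) by (simp add: measurable_completion)
  have d: "distr lebesgue lborel T = lborel"
    using distr_completion[of T lborel lborel] T by (simp cong: distr_cong)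
  have "completion (distr lebesgue lborel T) = distr lebesgue lebesgue T"
    by (rule completion.completion_distr_eq[OF TB]) (simp add: d)
  then have d: "distr lebesgue lebesgue T = lebesgue" by (simp add: d)
  show "integrable lebesgue (\<lambda>x. f (T x)) \<longleftrightarrow> integrable lebesgue f"
    using integrable_distr_eq[OF TL, of f] f by (simp add: d)
  show "(LINT x|lebesgue. f (T x)) = (LINT x|lebesgue. f x)"
    using integral_distr[OF TL, of f] f by (simp add: d)
qed

lemma nn_integral_lborel_affine:
  fixes f :: "'a::euclidean_space \<Rightarrow> ennreal"
  assumes [measurable]: "f \<in> borel_measurable borel" and "\<bar>c\<bar> = 1"
  shows "(\<integral>\<^sup>+ x. f (t + c *\<^sub>R x) \<partial>lborel) = (\<integral>\<^sup>+ x. f x \<partial>lborel)"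
proof -
  have "c \<noteq> 0" using assms(2) by auto
  from lborel_affine[OF this, of t] assms(2)
  have "lborel = distr lborel borel (\<lambda>x. t + c *\<^sub>R x)" by (simp add: density_1)
  then have "(\<integral>\<^sup>+ x. f x \<partial>lborel) = (\<integral>\<^sup>+ x. f x \<partial>distr lborel borel (\<lambda>x. t + c *\<^sub>R x))" by simp
  then show ?thesis by (simp add: nn_integral_distr)
qed

lemma nn_integral_lborel_pair:
  fixes f :: "('a::euclidean_space \<times> 'b::euclidean_space) \<Rightarrow> ennreal"
  assumes f: "f \<in> borel_measurable borel"
  shows "(\<integral>\<^sup>+ p. f p \<partial>lborel) = (\<integral>\<^sup>+ x. \<integral>\<^sup>+ y. f (x, y) \<partial>lborel \<partial>lborel)"
proof -
  have "f \<in> borel_measurable (lborel \<Otimes>\<^sub>M lborel)" using f by (simp add: lborel_prod)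
  from lborel.nn_integral_fst[OF this] show ?thesis by (simp add: lborel_prod)
qed

lemma nn_integral_lborel_case_prod:
  assumes "(\<lambda>(x, y). f x y) \<in> borel_measurable (borel \<Otimes>\<^sub>M borel)"
  shows "(\<integral>\<^sup>+ (x, y). f x y \<partial>(lborel :: ('a::euclidean_space \<times> 'b::euclidean_space) measure))
    = (\<integral>\<^sup>+ x. \<integral>\<^sup>+ y. f x y \<partial>lborel \<partial>lborel)"
  using nn_integral_lborel_pair[of "\<lambda>(x, y). f x y"] assms by (simp add: borel_prod)

text \<open>
The two symmetries of the kernel, as measure-preserving maps on pairs: exchanging the points, and
reflecting the second point at the first, which maps \<open>(x, x + z)\<close> to \<open>(x, x - z)\<close>.
\<close>

definition swap :: "'a \<times> 'a \<Rightarrow> 'a \<times> 'a" where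
  "swap p = (snd p, fst p)"

definition reflect :: "('a::real_vector) \<times> 'a \<Rightarrow> 'a \<times> 'a" where
  "reflect p = (fst p, 2 *\<^sub>R fst p - snd p)"

lemma swap_measurable [measurable]:
  "(swap :: ('a::euclidean_space \<times> 'a) \<Rightarrow> _) \<in> borel \<rightarrow>\<^sub>M borel"
  unfolding swap_def[abs_def] by (intro borel_measurable_continuous_onI continuous_intros)

lemma reflect_measurable [measurable]:
  "(reflect :: ('a::euclidean_space \<times> 'a) \<Rightarrow> _) \<in> borel \<rightarrow>\<^sub>M borel"
  unfolding reflect_def[abs_def] by (intro borel_measurable_continuous_onI continuous_intros)

lemma swap_measure_preserving:
  "distr lborel borel swap = (lborel :: ('a::euclidean_space \<times> 'a) measure)"
proof -
  have "(swap :: 'a \<times> 'a \<Rightarrow> _) = (\<lambda>(x, y). (y, x))" by (auto simp: swap_def)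
  with lborel_pair.distr_pair_swap[where 'a = 'a and 'b = 'a]
  have "lborel = distr lborel (lborel \<Otimes>\<^sub>M lborel) (swap :: 'a \<times> 'a \<Rightarrow> _)" by (simp add: lborel_prod)
  also have "\<dots> = distr lborel borel swap" by (rule distr_cong) (simp_all only: lborel_prod sets_lborel)
  finally show ?thesis ..
qed

lemma reflect_measure_preserving:
  "distr lborel borel reflect = (lborel :: ('a::euclidean_space \<times> 'a) measure)"
proof (rule measure_eqI)
  fix A :: "('a \<times> 'a) set"
  assume "A \<in> sets (distr lborel borel reflect)"
  then have A[measurable]: "A \<in> sets borel" by simp
  have "emeasure (distr lborel borel reflect) A = (\<integral>\<^sup>+ p. indicator A (reflect p) \<partial>lborel)"
    using nn_integral_distr[of reflect lborel borel "indicator A"]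
    by (simp add: nn_integral_indicator)
  also have "\<dots> = (\<integral>\<^sup>+ x. \<integral>\<^sup>+ y. indicator A (reflect (x, y)) \<partial>lborel \<partial>lborel)"
    by (rule nn_integral_lborel_pair) measurable
  also have "\<dots> = (\<integral>\<^sup>+ x. \<integral>\<^sup>+ y. indicator A (x, y) \<partial>lborel \<partial>lborel)"
  proof (rule nn_integral_cong)
    fix x :: 'a
    have [measurable]: "Pair x \<in> borel \<rightarrow>\<^sub>M borel"
      by (intro borel_measurable_continuous_onI continuous_intros)
    show "(\<integral>\<^sup>+ y. indicator A (reflect (x, y)) \<partial>lborel) = (\<integral>\<^sup>+ y. indicator A (x, y) \<partial>lborel)"
      using nn_integral_lborel_affine[of "\<lambda>y. indicator A (x, y)" "-1" "2 *\<^sub>R x"]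
      by (simp add: reflect_def)
  qed
  also have "\<dots> = (\<integral>\<^sup>+ p. indicator A p \<partial>lborel)"
    by (rule nn_integral_lborel_pair[symmetric]) measurable
  finally show "emeasure (distr lborel borel reflect) A = emeasure lborel A" by simp
qed simp

lemma lebesgue_measurable_fst:
  fixes f :: "'a::euclidean_space \<Rightarrow> 'c::topological_space"
  assumes "f \<in> borel_measurable lebesgue"
  shows "(\<lambda>p. f (fst p)) \<in> borel_measurable (lebesgue :: ('a \<times> 'b::euclidean_space) measure)"
proof -
  have "fst \<in> borel_measurable (borel :: ('a \<times> 'b) measure)"
    by (intro borel_measurable_continuous_onI continuous_intros)
  from lebesgue_measurable_if_null(1)[OF this fst_vimage_null] assms show ?thesis
    by (rule measurable_compose)
qed

lemma lebesgue_measurable_swap: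
  "(swap :: ('a::euclidean_space \<times> 'a) \<Rightarrow> _) \<in> lebesgue \<rightarrow>\<^sub>M lebesgue"
  by (rule lebesgue_measurable_if_null[OF swap_measurable
        measure_preserving_vimage_null[OF swap_measurable swap_measure_preserving]])

lemma lebesgue_measurable_snd:
  fixes f :: "'a::euclidean_space \<Rightarrow> 'c::topological_space"
  assumes "f \<in> borel_measurable lebesgue"
  shows "(\<lambda>p. f (snd p)) \<in> borel_measurable (lebesgue :: ('a \<times> 'a) measure)"
  using measurable_compose[OF lebesgue_measurable_swap lebesgue_measurable_fst[OF assms]]
  by (simp add: swap_def)

text \<open>
For fixed \<open>z = y - x\<close> each of the three indicators integrates to the measure of \<open>B\<close> by translation
invariance, which handles the constant \<open>\<alpha>\<close>; for the part with \<open>q\<close> the indicators are simply bounded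
by 1. Replacing \<open>q\<close> by a Borel version makes Tonelli's theorem applicable.
\<close>

lemma kernel_integral_bound:
  fixes q k :: "'a::euclidean_space \<Rightarrow> ennreal" and B :: "'a set"
  assumes q: "q \<in> borel_measurable lebesgue" and [measurable]: "k \<in> borel_measurable borel" "B \<in> sets borel"
  shows "(\<integral>\<^sup>+ (x, y). (\<alpha> + q x) * k (y - x) *
        (indicator B x + indicator B y + indicator B (2 *\<^sub>R x - y)) \<partial>lebesgue)
      \<le> 3 * (\<alpha> * emeasure lborel B + (\<integral>\<^sup>+ x. q x \<partial>lebesgue)) * (\<integral>\<^sup>+ z. k z \<partial>lborel)"
proof -
  obtain q' where [measurable]: "q' \<in> borel_measurable borel" and q': "AE x in lborel. q x = q' x"
    using completion_ex_borel_measurable[OF q] by auto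
  let ?T = "\<lambda>x y. indicator B x + indicator B y + indicator B (2 *\<^sub>R x - y) :: ennreal"
  let ?K = "\<integral>\<^sup>+ z. k z \<partial>lborel"
  have ae: "AE p in (lborel :: ('a \<times> 'a) measure). q (fst p) = q' (fst p)"
    by (rule lebesgue_measurable_if_null(2)[OF _ fst_vimage_null q'])
       (intro borel_measurable_continuous_onI continuous_intros)
  have T3: "?T x y \<le> 3" for x y
    by (auto simp: indicator_def)
  have "(\<integral>\<^sup>+ (x, y). (\<alpha> + q x) * k (y - x) * ?T x y \<partial>lebesgue)
      = (\<integral>\<^sup>+ (x, y). (\<alpha> + q' x) * k (y - x) * ?T x y \<partial>lborel)"
    unfolding nn_integral_completion
    by (rule nn_integral_cong_AE) (use ae in \<open>auto simp: case_prod_beta\<close>)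
  also have "\<dots> \<le> (\<integral>\<^sup>+ (x, y). \<alpha> * (k (y - x) * ?T x y) + 3 * (q' x * k (y - x)) \<partial>lborel)"
  proof (rule nn_integral_mono, clarify)
    fix x y :: 'a
    have "(\<alpha> + q' x) * k (y - x) * ?T x y = \<alpha> * (k (y - x) * ?T x y) + q' x * k (y - x) * ?T x y"
      by (simp only: distrib_right mult.assoc)
    also have "q' x * k (y - x) * ?T x y \<le> q' x * k (y - x) * 3"
      by (rule mult_left_mono[OF T3]) simp
    finally show "(\<alpha> + q' x) * k (y - x) * ?T x y \<le> \<alpha> * (k (y - x) * ?T x y) + 3 * (q' x * k (y - x))"
      by (simp add: mult_ac add_left_mono)
  qed
  also have "\<dots> = (\<integral>\<^sup>+ x. \<integral>\<^sup>+ y. \<alpha> * (k (y - x) * ?T x y) + 3 * (q' x * k (y - x)) \<partial>lborel \<partial>lborel)"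
    by (rule nn_integral_lborel_case_prod) measurable
  also have "\<dots> = (\<integral>\<^sup>+ x. \<integral>\<^sup>+ z. \<alpha> * (k z * ?T x (x + z)) + 3 * (q' x * k z) \<partial>lborel \<partial>lborel)"
  proof (rule nn_integral_cong)
    fix x
    show "(\<integral>\<^sup>+ y. \<alpha> * (k (y - x) * ?T x y) + 3 * (q' x * k (y - x)) \<partial>lborel)
        = (\<integral>\<^sup>+ z. \<alpha> * (k z * ?T x (x + z)) + 3 * (q' x * k z) \<partial>lborel)"
      using nn_integral_lborel_affine[of "\<lambda>y. \<alpha> * (k (y - x) * ?T x y) + 3 * (q' x * k (y - x))" 1 x]
      by simp
  qed
  also have "\<dots> = \<alpha> * (\<integral>\<^sup>+ x. \<integral>\<^sup>+ z. k z * ?T x (x + z) \<partial>lborel \<partial>lborel)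
      + 3 * ((\<integral>\<^sup>+ x. q' x \<partial>lborel) * ?K)"
    by (simp add: nn_integral_add nn_integral_cmult nn_integral_multc)
  also have "(\<integral>\<^sup>+ x. \<integral>\<^sup>+ z. k z * ?T x (x + z) \<partial>lborel \<partial>lborel)
      = (\<integral>\<^sup>+ z. \<integral>\<^sup>+ x. k z * ?T x (x + z) \<partial>lborel \<partial>lborel)"
    by (rule lborel_pair.Fubini'[symmetric]) measurable
  also have "\<dots> = (\<integral>\<^sup>+ z. k z * (3 * emeasure lborel B) \<partial>lborel)"
  proof (rule nn_integral_cong)
    fix z
    have 1: "(\<integral>\<^sup>+ x. indicator B (x + z) \<partial>lborel) = emeasure lborel B"
      using nn_integral_lborel_affine[of "indicator B" 1 z] by (simp add: add.commute)
    have "2 *\<^sub>R x - (x + z) = - z + 1 *\<^sub>R x" for x :: 'a by (simp add: scaleR_2)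
    then have 2: "(\<integral>\<^sup>+ x. indicator B (2 *\<^sub>R x - (x + z)) \<partial>lborel) = emeasure lborel B"
      using nn_integral_lborel_affine[of "indicator B" 1 "- z"]
      by (simp only: nn_integral_indicator \<open>B \<in> sets borel\<close> sets_lborel borel_measurable_indicator abs_one)
    have "(\<integral>\<^sup>+ x. k z * ?T x (x + z) \<partial>lborel) = k z * (emeasure lborel B + emeasure lborel B + emeasure lborel B)"
      using 1 2 by (simp add: nn_integral_cmult nn_integral_add)
    moreover have "e + e + e = 3 * e" for e :: ennreal
    proof -
      have "3 * e = (1 + 1 + 1) * e" by simp
      then show ?thesis by (simp only: distrib_right mult_1_left)
    qed
    ultimately show "(\<integral>\<^sup>+ x. k z * ?T x (x + z) \<partial>lborel) = k z * (3 * emeasure lborel B)"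
      by simp
  qed
  also have "\<dots> = ?K * (3 * emeasure lborel B)"
    by (simp add: nn_integral_multc)
  also have "(\<integral>\<^sup>+ x. q' x \<partial>lborel) = (\<integral>\<^sup>+ x. q x \<partial>lebesgue)"
    unfolding nn_integral_completion using q' by (intro nn_integral_cong_AE) auto
  finally show ?thesis by (simp add: algebra_simps)
qed


section \<open>The truncated singular weight\<close>

text \<open>
The weight of a second difference at scale \<open>R\<close> against the singular kernel of order \<open>p\<close>. At
\<open>z = 0\<close> it is 0, since \<open>0 powr p = 0\<close> and division by 0 gives 0.
\<close>

definition levy_weight :: "real \<Rightarrow> real \<Rightarrow> 'a::euclidean_space \<Rightarrow> real" where
  "levy_weight p R z = min 1 ((norm z / R)\<^sup>2) / norm z powr p"

lemma levy_weight_measurable [measurable]: "levy_weight p R \<in> borel_measurable borel"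
  unfolding levy_weight_def[abs_def] by measurable

lemma levy_weight_nonneg: "0 \<le> levy_weight p R z"
  by (simp add: levy_weight_def)

text \<open>
A layer-cake estimate, which replaces polar coordinates: \<open>norm z powr (- p)\<close> is the integral of
\<open>p * r powr (- p - 1)\<close> over \<open>r \<ge> norm z\<close>, and \<open>min 1 ((r / R)\<^sup>2)\<close> increases with \<open>r\<close>.
\<close>

lemma levy_weight_le_tail_integral:
  fixes z :: "'a::euclidean_space"
  assumes "0 < p" "0 < R"
  shows "ennreal (levy_weight p R z)
    \<le> (\<integral>\<^sup>+ r. ennreal (p * min 1 ((r / R)\<^sup>2) * r powr (- p - 1)) * indicator {norm z..} r \<partial>lborel)"
proof (cases "z = 0")
  case False
  then have z: "norm z > 0" by simp
  let ?m = "p * min 1 ((norm z / R)\<^sup>2)"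
  have "((\<lambda>r. r powr (- p - 1)) has_integral -(norm z powr (- p - 1 + 1)) / (- p - 1 + 1)) {norm z..}"
    using z assms by (intro has_integral_powr_to_inf) auto
  from has_integral_mult_right[OF this, of ?m]
  moreover have "?m * (-(norm z powr (- p - 1 + 1)) / (- p - 1 + 1)) = levy_weight p R z"
    using assms by (simp add: levy_weight_def powr_minus field_simps)
  ultimately have I: "((\<lambda>r. ?m * r powr (- p - 1)) has_integral levy_weight p R z) {norm z..}"
    by simp
  have "(\<integral>\<^sup>+ r. ennreal (?m * r powr (- p - 1)) * indicator {norm z..} r \<partial>lborel) = ennreal (levy_weight p R z)"
    by (rule nn_integral_has_integral_lebesgue'[OF _ I]) (use assms in auto)
  then have "ennreal (levy_weight p R z) = (\<integral>\<^sup>+ r. ennreal (?m * r powr (- p - 1)) * indicator {norm z..} r \<partial>lborel)" ..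
  also have "\<dots> \<le> (\<integral>\<^sup>+ r. ennreal (p * min 1 ((r / R)\<^sup>2) * r powr (- p - 1)) * indicator {norm z..} r \<partial>lborel)"
  proof (rule nn_integral_mono)
    fix r :: real
    have "?m * r powr (- p - 1) \<le> p * min 1 ((r / R)\<^sup>2) * r powr (- p - 1)" if "norm z \<le> r"
    proof -
      have "(norm z / R)\<^sup>2 \<le> (r / R)\<^sup>2"
        using that assms by (intro power_mono divide_right_mono) auto
      then show ?thesis using assms by (intro mult_right_mono mult_left_mono min.mono) auto
    qed
    then show "ennreal (?m * r powr (- p - 1)) * indicator {norm z..} r
        \<le> ennreal (p * min 1 ((r / R)\<^sup>2) * r powr (- p - 1)) * indicator {norm z..} r"
      by (auto simp: indicator_def intro!: ennreal_leI)
  qed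
  finally show ?thesis .
qed (simp add: levy_weight_def)

text \<open>
After exchanging the order of integration only the volume of balls is needed. The condition
\<open>\<sigma> < 2\<close> gives integrability for small \<open>r\<close>, and \<open>0 < \<sigma>\<close> for large \<open>r\<close>; splitting at \<open>r = R\<close>
produces the scaling \<open>R powr (- \<sigma>)\<close> on both sides.
\<close>

lemma nn_integral_levy_weight:
  assumes \<sigma>: "0 < \<sigma>" "\<sigma> < 2" and R: "0 < R"
  shows "(\<integral>\<^sup>+ z. ennreal (levy_weight (real DIM('a) + \<sigma>) R z) \<partial>(lborel :: 'a::euclidean_space measure))
    \<le> ennreal ((real DIM('a) + \<sigma>) * unit_ball_vol DIM('a) * (1 / (2 - \<sigma>) + 1 / \<sigma>) * R powr (- \<sigma>))"
proof -
  define p where "p = real DIM('a) + \<sigma>"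
  define V where "V = unit_ball_vol DIM('a)"
  have p: "0 < p" using \<sigma> by (simp add: p_def)
  have V: "0 \<le> V" by (simp add: V_def)
  let ?w = "\<lambda>r. p * min 1 ((r / R)\<^sup>2) * r powr (- p - 1)"
  have "(\<integral>\<^sup>+ z. ennreal (levy_weight p R z) \<partial>(lborel :: 'a measure))
      \<le> (\<integral>\<^sup>+ z. \<integral>\<^sup>+ r. ennreal (?w r) * indicator {norm z..} r \<partial>lborel \<partial>(lborel :: 'a measure))"
    by (intro nn_integral_mono levy_weight_le_tail_integral p R)
  also have "\<dots> = (\<integral>\<^sup>+ r. \<integral>\<^sup>+ z. ennreal (?w r) * indicator {norm z..} r \<partial>(lborel :: 'a measure) \<partial>lborel)"
    unfolding indicator_def atLeast_iff by (rule lborel_pair.Fubini'[symmetric]) measurable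
  also have "\<dots> = (\<integral>\<^sup>+ r. ennreal (?w r) * (indicator {0..} r * ennreal (V * r ^ DIM('a))) \<partial>lborel)"
  proof (rule nn_integral_cong)
    fix r :: real
    have "(\<lambda>z::'a. indicator {norm z..} r :: ennreal) = indicator (cball 0 r)"
      by (auto simp: indicator_def fun_eq_iff)
    then have "(\<integral>\<^sup>+ z. indicator {norm z..} r \<partial>(lborel :: 'a measure)) = emeasure lborel (cball (0::'a) r)"
      by simp
    also have "\<dots> = indicator {0..} r * ennreal (V * r ^ DIM('a))"
      using emeasure_cball[of r "0::'a"] by (cases "0 \<le> r") (auto simp: V_def)
    finally show "(\<integral>\<^sup>+ z. ennreal (?w r) * indicator {norm z..} r \<partial>(lborel :: 'a measure))
        = ennreal (?w r) * (indicator {0..} r * ennreal (V * r ^ DIM('a)))"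
      by (subst nn_integral_cmult) (auto intro!: borel_measurable_indicator' simp: indicator_def[of "{_..}"])
  qed
  also have "\<dots> \<le> (\<integral>\<^sup>+ r. ennreal (p * V / R\<^sup>2 * r powr (1 - \<sigma>)) * indicator {0..R} r
      + ennreal (p * V * r powr (- \<sigma> - 1)) * indicator {R..} r \<partial>lborel)"
  proof (rule nn_integral_mono)
    fix r :: real
    show "ennreal (?w r) * (indicator {0..} r * ennreal (V * r ^ DIM('a)))
        \<le> ennreal (p * V / R\<^sup>2 * r powr (1 - \<sigma>)) * indicator {0..R} r
          + ennreal (p * V * r powr (- \<sigma> - 1)) * indicator {R..} r"
    proof (cases "r > 0")
      case True
      have "?w r * (V * r ^ DIM('a)) = p * V * min 1 ((r / R)\<^sup>2) * (r powr (- p - 1) * r powr DIM('a))"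
        using True by (simp add: powr_realpow mult_ac)
      also have "r powr (- p - 1) * r powr DIM('a) = r powr (- \<sigma> - 1)"
        by (simp add: p_def flip: powr_add)
      finally have w: "?w r * (V * r ^ DIM('a)) = p * V * (min 1 ((r / R)\<^sup>2) * r powr (- \<sigma> - 1))" by simp
      have r2: "r\<^sup>2 * r powr (- \<sigma> - 1) = r powr (1 - \<sigma>)"
      proof -
        have "r\<^sup>2 * r powr (- \<sigma> - 1) = r powr 2 * r powr (- \<sigma> - 1)" using True by simp
        also have "\<dots> = r powr (1 - \<sigma>)" unfolding powr_add[symmetric] by simp
        finally show ?thesis .
      qed
      have eq: "ennreal (?w r) * (indicator {0..} r * ennreal (V * r ^ DIM('a)))
          = ennreal (p * V * (min 1 ((r / R)\<^sup>2) * r powr (- \<sigma> - 1)))"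
        unfolding w[symmetric] using True p V by (simp add: ennreal_mult'[symmetric])
      show ?thesis
      proof (cases "r \<le> R")
        case le: True
        have "min 1 ((r / R)\<^sup>2) * r powr (- \<sigma> - 1) \<le> (r / R)\<^sup>2 * r powr (- \<sigma> - 1)"
          by (intro mult_right_mono) auto
        also have "\<dots> = r powr (1 - \<sigma>) / R\<^sup>2"
          using r2 by (simp add: power_divide)
        finally have "p * V * (min 1 ((r / R)\<^sup>2) * r powr (- \<sigma> - 1)) \<le> p * V * (r powr (1 - \<sigma>) / R\<^sup>2)"
          using p V by (intro mult_left_mono) auto
        then have "p * V * (min 1 ((r / R)\<^sup>2) * r powr (- \<sigma> - 1)) \<le> p * V / R\<^sup>2 * r powr (1 - \<sigma>)"
          by (simp only: times_divide_eq_left times_divide_eq_right)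
        then show ?thesis unfolding eq using True le by (intro add_increasing2) (auto intro: ennreal_leI)
      next
        case False
        have "min 1 ((r / R)\<^sup>2) * r powr (- \<sigma> - 1) \<le> 1 * r powr (- \<sigma> - 1)"
          by (intro mult_right_mono) auto
        then have "p * V * (min 1 ((r / R)\<^sup>2) * r powr (- \<sigma> - 1)) \<le> p * V * r powr (- \<sigma> - 1)"
          unfolding mult_1_left using p V by (intro mult_left_mono) auto
        then show ?thesis unfolding eq using False by (intro add_increasing) (auto intro: ennreal_leI)
      qed
    next
      case False
      then show ?thesis by (cases "r = 0") auto
    qed
  qed
  also have "\<dots> = (\<integral>\<^sup>+ r. ennreal (p * V / R\<^sup>2 * r powr (1 - \<sigma>)) * indicator {0..R} r \<partial>lborel)
      + (\<integral>\<^sup>+ r. ennreal (p * V * r powr (- \<sigma> - 1)) * indicator {R..} r \<partial>lborel)"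
    by (rule nn_integral_add) measurable
  also have "(\<integral>\<^sup>+ r. ennreal (p * V / R\<^sup>2 * r powr (1 - \<sigma>)) * indicator {0..R} r \<partial>lborel)
      = ennreal (p * V / R\<^sup>2 * (R powr (1 - \<sigma> + 1) / (1 - \<sigma> + 1)))"
    using p V \<sigma> R
    by (intro nn_integral_has_integral_lebesgue' has_integral_mult_right has_integral_powr_from_0) auto
  also have "(\<integral>\<^sup>+ r. ennreal (p * V * r powr (- \<sigma> - 1)) * indicator {R..} r \<partial>lborel)
      = ennreal (p * V * (-(R powr (- \<sigma> - 1 + 1)) / (- \<sigma> - 1 + 1)))"
    using p V \<sigma> R
    by (intro nn_integral_has_integral_lebesgue' has_integral_mult_right has_integral_powr_to_inf) auto
  also have "ennreal (p * V / R\<^sup>2 * (R powr (1 - \<sigma> + 1) / (1 - \<sigma> + 1)))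
      + ennreal (p * V * (-(R powr (- \<sigma> - 1 + 1)) / (- \<sigma> - 1 + 1)))
      = ennreal (p * V * (1 / (2 - \<sigma>) + 1 / \<sigma>) * R powr (- \<sigma>))"
  proof -
    have "R powr (1 - \<sigma> + 1) = R\<^sup>2 * R powr (- \<sigma>)"
    proof -
      have "R\<^sup>2 * R powr (- \<sigma>) = R powr 2 * R powr (- \<sigma>)" using R by simp
      also have "\<dots> = R powr (1 - \<sigma> + 1)" unfolding powr_add[symmetric] by simp
      finally show ?thesis ..
    qed
    then have "p * V / R\<^sup>2 * (R powr (1 - \<sigma> + 1) / (1 - \<sigma> + 1)) + p * V * (-(R powr (- \<sigma> - 1 + 1)) / (- \<sigma> - 1 + 1))
        = p * V * (1 / (2 - \<sigma>) + 1 / \<sigma>) * R powr (- \<sigma>)"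
      using \<sigma> R by (simp add: algebra_simps)
    moreover have "0 \<le> p * V / R\<^sup>2 * (R powr (1 - \<sigma> + 1) / (1 - \<sigma> + 1))"
      "0 \<le> p * V * (-(R powr (- \<sigma> - 1 + 1)) / (- \<sigma> - 1 + 1))"
      using p V \<sigma> by simp_all
    ultimately show ?thesis by (simp only: ennreal_plus[symmetric])
  qed
  finally show ?thesis by (simp add: p_def V_def)
qed

section \<open>The bilinear form against a rescaled bump\<close>

lemma kernel_integral_bound_real:
  fixes q k :: "'a::euclidean_space \<Rightarrow> real" and B :: "'a set"
  assumes q: "integrable lebesgue q" "\<And>x. 0 \<le> q x" and a: "0 \<le> a"
    and k[measurable]: "k \<in> borel_measurable borel" and k0: "\<And>z. 0 \<le> k z"
    and K: "(\<integral>\<^sup>+ z. ennreal (k z) \<partial>lborel) \<le> ennreal K" "0 \<le> K"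
    and B[measurable]: "B \<in> sets borel" and b: "emeasure lborel B = ennreal b" "0 \<le> b"
  defines "G \<equiv> \<lambda>p. (a + q (fst p)) * k (snd p - fst p) *
      (indicator B (fst p) + indicator B (snd p) + indicator B (2 *\<^sub>R fst p - snd p))"
  shows "integrable lebesgue G" and "(LINT p|lebesgue. G p) \<le> 3 * (a * b + (LINT x|lebesgue. q x)) * K"
proof -
  have qm: "q \<in> borel_measurable lebesgue" using q by auto
  have "(\<lambda>p. k (snd p - fst p) *
      (indicator B (fst p) + indicator B (snd p) + indicator B (2 *\<^sub>R fst p - snd p)))
      \<in> borel_measurable (borel \<Otimes>\<^sub>M borel :: ('a \<times> 'a) measure)" by measurable
  then have T: "(\<lambda>p. k (snd p - fst p) *
      (indicator B (fst p) + indicator B (snd p) + indicator B (2 *\<^sub>R fst p - snd p)))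
      \<in> borel_measurable (lebesgue :: ('a \<times> 'a) measure)"
    unfolding borel_prod by (intro measurable_completion) simp
  have Gm: "G \<in> borel_measurable lebesgue"
    unfolding G_def mult.assoc
    by (intro borel_measurable_times[OF _ T] borel_measurable_add borel_measurable_const lebesgue_measurable_fst qm)
  have G0: "0 \<le> G p" for p
    using q a k0 by (simp add: G_def)
  have i: "0 \<le> (LINT x|lebesgue. q x)" using q by simp
  have "(\<integral>\<^sup>+ p. ennreal (G p) \<partial>lebesgue)
      = (\<integral>\<^sup>+ (x, y). (ennreal a + ennreal (q x)) * ennreal (k (y - x)) *
        (indicator B x + indicator B y + indicator B (2 *\<^sub>R x - y)) \<partial>lebesgue)"
  proof (rule nn_integral_cong)
    fix p :: "'a \<times> 'a"
    have ind: "ennreal (indicator B x) = indicator B x" for x :: 'a by (simp add: indicator_def)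
    show "ennreal (G p) = (case p of (x, y) \<Rightarrow> (ennreal a + ennreal (q x)) * ennreal (k (y - x)) *
        (indicator B x + indicator B y + indicator B (2 *\<^sub>R x - y)))"
      using q a k0 by (simp add: G_def case_prod_beta ennreal_mult ennreal_plus ind)
  qed
  also have "\<dots> \<le> 3 * (ennreal a * emeasure lborel B + (\<integral>\<^sup>+ x. ennreal (q x) \<partial>lebesgue))
      * (\<integral>\<^sup>+ z. ennreal (k z) \<partial>lborel)"
    by (rule kernel_integral_bound) (use qm in \<open>auto\<close>)
  also have "\<dots> \<le> 3 * (ennreal a * emeasure lborel B + (\<integral>\<^sup>+ x. ennreal (q x) \<partial>lebesgue)) * ennreal K"
    by (rule mult_left_mono[OF K(1)]) simp
  also have "(\<integral>\<^sup>+ x. ennreal (q x) \<partial>lebesgue) = ennreal (LINT x|lebesgue. q x)"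
    using q by (intro nn_integral_eq_integral) auto
  also have "3 * (ennreal a * emeasure lborel B + ennreal (LINT x|lebesgue. q x)) * ennreal K
      = ennreal (3 * (a * b + (LINT x|lebesgue. q x)) * K)"
    using a b K i by (simp add: ennreal_mult ennreal_plus)
  finally have le: "(\<integral>\<^sup>+ p. ennreal (G p) \<partial>lebesgue) \<le> ennreal (3 * (a * b + (LINT x|lebesgue. q x)) * K)" .
  show int: "integrable lebesgue G"
    by (rule integrableI_bounded[OF Gm]) (use le G0 in \<open>auto simp: order_le_less_trans\<close>)
  show "(LINT p|lebesgue. G p) \<le> 3 * (a * b + (LINT x|lebesgue. q x)) * K"
    using le nn_integral_eq_integral[OF int] G0 a b K i by (simp add: ennreal_le_iff)
qed

text \<open>
The truncation makes \<open>H\<close>, which carries the difference of \<open>g\<close> but only one value of \<open>v\<close>, absolutely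
integrable. Hence the integrand of the form, which is \<open>H\<close> plus its image under \<open>swap\<close>, has the same
integral as \<open>H\<close> plus its image under \<open>reflect\<close>, and the latter sum is the second difference.
\<close>

lemma truncated_form_bound:
  fixes J :: "real ^ 'n \<Rightarrow> real ^ 'n \<Rightarrow> real" and v q g :: "real ^ 'n \<Rightarrow> real"
  assumes J: "admissible_kernel \<sigma> \<Lambda> J" and "0 < \<Lambda>" and R: "0 < R" and C: "0 \<le> C"
    and vm: "v \<in> borel_measurable lebesgue" and v: "\<And>x. \<bar>v x\<bar> \<le> a + q x"
    and gm: "g \<in> borel_measurable borel"
    and g1: "\<And>x y. \<bar>g x - g y\<bar> \<le> indicator B x + indicator B y"
    and g2: "\<And>x y. \<bar>2 * g x - g y - g (2 *\<^sub>R x - y)\<bar> \<le> C * min 1 ((norm (y - x) / R)\<^sup>2) *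
        (indicator B x + indicator B y + indicator B (2 *\<^sub>R x - y))"
  defines "G \<equiv> \<lambda>p. (a + q (fst p)) * levy_weight (real CARD('n) + \<sigma>) R (snd p - fst p) *
      (indicator B (fst p) + indicator B (snd p) + indicator B (2 *\<^sub>R fst p - snd p))"
  assumes G: "integrable lebesgue G" and \<epsilon>: "0 < \<epsilon>"
  shows "\<bar>LINT p|lebesgue. (v (fst p) - v (snd p)) * (g (fst p) - g (snd p)) * J (fst p) (snd p)
      * indicator {p. \<epsilon> < norm (snd p - fst p)} p\<bar> \<le> \<Lambda> * C * (LINT p|lebesgue. G p)"
proof -
  let ?p = "real CARD('n) + \<sigma>"
  define e where "e p = (indicator {p. \<epsilon> < norm (snd p - fst p)} p :: real)" for p :: "(real ^ 'n) \<times> (real ^ 'n)"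
  define H where "H p = v (fst p) * (g (fst p) - g (snd p)) * J (fst p) (snd p) * e p" for p
  define S where "S p = v (fst p) * (2 * g (fst p) - g (snd p) - g (2 *\<^sub>R fst p - snd p)) * J (fst p) (snd p) * e p" for p
  have Jm: "(\<lambda>p. J (fst p) (snd p)) \<in> borel_measurable lebesgue"
    using J by (simp add: admissible_kernel_def case_prod_beta')
  have Jsym: "x \<noteq> y \<Longrightarrow> J x y = J y x" for x y
    using J by (simp add: admissible_kernel_def)
  have Jrefl: "x \<noteq> y \<Longrightarrow> J x (2 *\<^sub>R x - y) = J x y" for x y
  proof -
    assume "x \<noteq> y"
    moreover have "\<forall>x z. z \<noteq> 0 \<longrightarrow> J x (x + z) = J x (x - z)"
      using J unfolding admissible_kernel_def by blast
    ultimately have "J x (x + (y - x)) = J x (x - (y - x))"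
      by (metis right_minus_eq)
    then show ?thesis by (simp add: scaleR_2 algebra_simps)
  qed
  have Jbd: "\<bar>J x y\<bar> \<le> \<Lambda> / norm (y - x) powr ?p" if "x \<noteq> y" for x y
  proof -
    have "1 / (\<Lambda> * norm (x - y) powr ?p) \<le> J x y" "J x y \<le> \<Lambda> / norm (x - y) powr ?p"
      using J that unfolding admissible_kernel_def by auto
    moreover have "0 \<le> 1 / (\<Lambda> * norm (x - y) powr ?p)"
      using \<open>0 < \<Lambda>\<close> by (intro divide_nonneg_nonneg mult_nonneg_nonneg) auto
    ultimately have "\<bar>J x y\<bar> \<le> \<Lambda> / norm (x - y) powr ?p" by linarith
    then show ?thesis by (simp only: norm_minus_commute)
  qed
  have "{p. \<epsilon> < norm (snd p - fst p)} \<in> sets (borel :: ((real ^ 'n) \<times> (real ^ 'n)) measure)"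
    by (intro borel_open open_Collect_less continuous_intros)
  then have em: "e \<in> borel_measurable lebesgue"
    unfolding e_def[abs_def] by (intro measurable_completion) simp
  have gL: "g \<in> borel_measurable lebesgue" using gm by (simp add: measurable_completion)
  have Hm: "H \<in> borel_measurable lebesgue"
    unfolding H_def[abs_def]
    by (intro borel_measurable_times borel_measurable_diff lebesgue_measurable_fst lebesgue_measurable_snd Jm em vm gL)
  have aq: "0 \<le> a + q x" for x using v[of x] by linarith
  have w0: "0 \<le> levy_weight ?p R z" for z :: "real ^ 'n" by (rule levy_weight_nonneg)
  let ?T = "\<lambda>p. indicator B (fst p) + indicator B (snd p) + indicator B (2 *\<^sub>R fst p - snd p) :: real"
  \<comment> \<open>On the truncated region the first difference is dominated as well, at the price of a constant depending on \<open>\<epsilon>\<close>.\<close>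
  define m where "m = min 1 ((\<epsilon> / R)\<^sup>2)"
  have m: "0 < m" using \<epsilon> R by (simp add: m_def)
  have Hbd: "\<bar>H p\<bar> \<le> \<Lambda> / m * G p" for p
  proof (cases "\<epsilon> < norm (snd p - fst p)")
    case True
    then have ne: "fst p \<noteq> snd p" using \<epsilon> by auto
    have "(\<epsilon> / R)\<^sup>2 \<le> (norm (snd p - fst p) / R)\<^sup>2"
      using True \<epsilon> R by (intro power_mono divide_right_mono) auto
    then have mm: "m \<le> min 1 ((norm (snd p - fst p) / R)\<^sup>2)" by (auto simp: m_def)
    have "1 / norm (snd p - fst p) powr ?p = m / norm (snd p - fst p) powr ?p / m"
      using m by simp
    also have "\<dots> \<le> levy_weight ?p R (snd p - fst p) / m"
      unfolding levy_weight_def using m mm by (intro divide_right_mono) auto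
    finally have "\<Lambda> * (1 / norm (snd p - fst p) powr ?p) \<le> \<Lambda> * (levy_weight ?p R (snd p - fst p) / m)"
      using \<open>0 < \<Lambda>\<close> by (intro mult_left_mono) auto
    with Jbd[OF ne] have j: "\<bar>J (fst p) (snd p)\<bar> \<le> \<Lambda> / m * levy_weight ?p R (snd p - fst p)" by simp
    have x: "\<bar>g (fst p) - g (snd p)\<bar> \<le> ?T p"
      using g1[of "fst p" "snd p"] by (rule order_trans) simp
    have "\<bar>H p\<bar> = \<bar>v (fst p)\<bar> * (\<bar>g (fst p) - g (snd p)\<bar> * \<bar>J (fst p) (snd p)\<bar>)"
      using True by (simp add: H_def e_def abs_mult)
    also have "\<dots> \<le> (a + q (fst p)) * (?T p * (\<Lambda> / m * levy_weight ?p R (snd p - fst p)))"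
      by (intro mult_mono v x j aq mult_nonneg_nonneg) auto
    also have "\<dots> = \<Lambda> / m * G p" unfolding G_def by (simp only: mult_ac)
    finally show ?thesis .
  next
    case False
    then have "H p = 0" by (simp add: H_def e_def)
    then show ?thesis using aq w0 m \<open>0 < \<Lambda>\<close> by (simp add: G_def)
  qed
  have Hint: "integrable lebesgue H"
    by (rule Bochner_Integration.integrable_bound[OF integrable_mult_right[OF G, of "\<Lambda> / m"] Hm])
       (intro AE_I2, unfold real_norm_def, rule order_trans[OF Hbd abs_ge_self])
  note sw = measure_preserving_lebesgue[OF swap_measurable swap_measure_preserving Hm]
  note re = measure_preserving_lebesgue[OF reflect_measurable reflect_measure_preserving Hm]
  have "(v (fst p) - v (snd p)) * (g (fst p) - g (snd p)) * J (fst p) (snd p) * e p = H p + H (swap p)" for p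
  proof -
    have e: "e (swap p) = e p" and "fst (swap p) = snd p" "snd (swap p) = fst p"
      by (simp_all add: e_def swap_def indicator_def norm_minus_commute)
    then have hs: "H (swap p) = v (snd p) * (g (snd p) - g (fst p)) * J (snd p) (fst p) * e p"
      by (simp add: H_def)
    show ?thesis
      using Jsym[of "fst p" "snd p"] unfolding hs unfolding H_def
      by (cases "fst p = snd p") (simp_all add: algebra_simps)
  qed
  then have "(LINT p|lebesgue. (v (fst p) - v (snd p)) * (g (fst p) - g (snd p)) * J (fst p) (snd p) * e p)
      = (LINT p|lebesgue. H p) + (LINT p|lebesgue. H (swap p))"
    using Hint sw by simp
  also have "\<dots> = (LINT p|lebesgue. H p) + (LINT p|lebesgue. H (reflect p))"
    using sw re by simp
  also have "\<dots> = (LINT p|lebesgue. H p + H (reflect p))"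
    using Hint re by simp
  also have "(\<lambda>p. H p + H (reflect p)) = S"
  proof
    fix p :: "(real ^ 'n) \<times> (real ^ 'n)"
    have "norm (2 *\<^sub>R fst p - snd p - fst p) = norm (snd p - fst p)"
      by (simp add: scaleR_2 norm_minus_commute)
    then have e: "e (reflect p) = e p" by (simp add: e_def reflect_def indicator_def)
    show "H p + H (reflect p) = S p"
    proof (cases "fst p = snd p")
      case True
      then have "e p = 0" using \<epsilon> by (simp add: e_def)
      then show ?thesis by (simp add: H_def S_def e)
    next
      case False
      have "H (reflect p) = v (fst p) * (g (fst p) - g (2 *\<^sub>R fst p - snd p)) * J (fst p) (snd p) * e p"
        unfolding H_def e by (simp add: reflect_def Jrefl[OF False])
      then show ?thesis by (simp add: H_def S_def algebra_simps)
    qed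
  qed
  also have "\<bar>LINT p|lebesgue. S p\<bar> \<le> (LINT p|lebesgue. \<Lambda> * C * G p)"
  proof (rule integral_abs_bound_integral)
    show "integrable lebesgue (\<lambda>p. \<Lambda> * C * G p)" using G by (rule integrable_mult_right)
    show "integrable lebesgue S"
      unfolding \<open>(\<lambda>p. H p + H (reflect p)) = S\<close>[symmetric] using Hint re by (intro Bochner_Integration.integrable_add) auto
    fix p
    show "\<bar>S p\<bar> \<le> \<Lambda> * C * G p"
    proof (cases "\<epsilon> < norm (snd p - fst p)")
      case True
      then have ne: "fst p \<noteq> snd p" using \<epsilon> by auto
      have "\<bar>S p\<bar> = \<bar>v (fst p)\<bar> * (\<bar>2 * g (fst p) - g (snd p) - g (2 *\<^sub>R fst p - snd p)\<bar> * \<bar>J (fst p) (snd p)\<bar>)"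
        using True by (simp add: S_def e_def abs_mult)
      also have "\<dots> \<le> (a + q (fst p)) * ((C * min 1 ((norm (snd p - fst p) / R)\<^sup>2) * ?T p) *
          (\<Lambda> / norm (snd p - fst p) powr ?p))"
        using C by (intro mult_mono v g2 Jbd[OF ne] aq mult_nonneg_nonneg) auto
      also have "\<dots> = \<Lambda> * C * G p" unfolding G_def levy_weight_def by (simp add: mult_ac)
      finally show ?thesis .
    next
      case False
      then have "S p = 0" by (simp add: S_def e_def)
      then show ?thesis using aq w0 \<open>0 < \<Lambda>\<close> C by (simp add: G_def)
    qed
  qed
  also have "\<dots> = \<Lambda> * C * (LINT p|lebesgue. G p)" by simp
  finally show ?thesis by (simp add: e_def)
qed

text \<open>
If the integrand of the form is not integrable then the form is 0 by convention and the bound is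
trivial; otherwise dominated convergence removes the truncation.
\<close>

lemma bilinear_form_bound:
  fixes J :: "real ^ 'n \<Rightarrow> real ^ 'n \<Rightarrow> real" and v q g :: "real ^ 'n \<Rightarrow> real"
  assumes J: "admissible_kernel \<sigma> \<Lambda> J" and "0 < \<Lambda>" and R: "0 < R" and C: "0 \<le> C"
    and vm: "v \<in> borel_measurable lebesgue" and v: "\<And>x. \<bar>v x\<bar> \<le> a + q x"
    and gm: "g \<in> borel_measurable borel"
    and g1: "\<And>x y. \<bar>g x - g y\<bar> \<le> indicator B x + indicator B y"
    and g2: "\<And>x y. \<bar>2 * g x - g y - g (2 *\<^sub>R x - y)\<bar> \<le> C * min 1 ((norm (y - x) / R)\<^sup>2) *
        (indicator B x + indicator B y + indicator B (2 *\<^sub>R x - y))"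
  defines "G \<equiv> \<lambda>p. (a + q (fst p)) * levy_weight (real CARD('n) + \<sigma>) R (snd p - fst p) *
      (indicator B (fst p) + indicator B (snd p) + indicator B (2 *\<^sub>R fst p - snd p))"
  assumes G: "integrable lebesgue G"
  shows "\<bar>bilinear_form J v g\<bar> \<le> \<Lambda> * C / 2 * (LINT p|lebesgue. G p)"
proof -
  define F where "F p = (v (fst p) - v (snd p)) * (g (fst p) - g (snd p)) * J (fst p) (snd p)" for p
  have form: "bilinear_form J v g = 1 / 2 * (LINT p|lebesgue. F p)"
    by (simp add: bilinear_form_def F_def case_prod_beta')
  have G0: "0 \<le> G p" for p
  proof -
    have "0 \<le> a + q (fst p)" using v[of "fst p"] by linarith
    then show ?thesis using levy_weight_nonneg[of "real CARD('n) + \<sigma>" R "snd p - fst p"] by (simp add: G_def)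
  qed
  have "\<bar>LINT p|lebesgue. F p\<bar> \<le> \<Lambda> * C * (LINT p|lebesgue. G p)"
  proof (cases "integrable lebesgue F")
    case True
    let ?A = "\<lambda>n::nat. {p :: (real ^ 'n) \<times> (real ^ 'n). 1 / (real n + 1) < norm (snd p - fst p)}"
    have A: "?A n \<in> sets lebesgue" for n
      by (intro sets_completionI_sets, simp) (intro borel_open open_Collect_less continuous_intros)
    have lim: "(\<lambda>n. LINT p|lebesgue. F p * indicator (?A n) p) \<longlonglongrightarrow> (LINT p|lebesgue. F p)"
    proof (rule integral_dominated_convergence[where w = "\<lambda>p. norm (F p)"])
      show "F \<in> borel_measurable lebesgue" using True by auto
      show "(\<lambda>p. F p * indicator (?A n) p) \<in> borel_measurable lebesgue" for n
        using True A[of n] by (intro borel_measurable_times borel_measurable_indicator) auto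
      show "integrable lebesgue (\<lambda>p. norm (F p))" using True by simp
      show "AE p in lebesgue. norm (F p * indicator (?A n) p) \<le> norm (F p)" for n
        by (intro AE_I2) (auto simp: indicator_def)
      show "AE p in lebesgue. (\<lambda>n. F p * indicator (?A n) p) \<longlonglongrightarrow> F p"
      proof (rule AE_I2)
        fix p
        show "(\<lambda>n. F p * indicator (?A n) p) \<longlonglongrightarrow> F p"
        proof (cases "fst p = snd p")
          case True
          then have "F p = 0" by (simp add: F_def)
          then show ?thesis by simp
        next
          case False
          have "(\<lambda>n. 1 / (real n + 1)) \<longlonglongrightarrow> 0"
            using LIMSEQ_inverse_real_of_nat by (simp add: inverse_eq_divide add.commute)
          then have "\<forall>\<^sub>F n in sequentially. 1 / (real n + 1) < norm (snd p - fst p)"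
            using False by (intro order_tendstoD) auto
          then have "\<forall>\<^sub>F n in sequentially. F p = F p * indicator (?A n) p"
            by eventually_elim simp
          then show ?thesis by (rule Lim_transform_eventually[OF tendsto_const])
        qed
      qed
    qed
    have "\<bar>LINT p|lebesgue. F p * indicator (?A n) p\<bar> \<le> \<Lambda> * C * (LINT p|lebesgue. G p)" for n
      unfolding F_def G_def
      by (rule truncated_form_bound[OF J \<open>0 < \<Lambda>\<close> R C vm v gm g1 g2 G[unfolded G_def]]) simp
    then show ?thesis
      by (intro tendsto_le[OF _ tendsto_const tendsto_rabs[OF lim]]) auto
  next
    case False
    then have "(LINT p|lebesgue. F p) = 0" by (rule not_integrable_integral_eq)
    moreover have "0 \<le> (LINT p|lebesgue. G p)" using G0 by simp
    ultimately show ?thesis using C \<open>0 < \<Lambda>\<close> by simp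
  qed
  then show ?thesis by (simp add: form abs_mult)
qed

text \<open>
The scaling that decides the theorem: the constant part \<open>a\<close> is paid for with the volume
\<open>R ^ N\<close> of the ball, the integrable part \<open>q\<close> only with its norm.
\<close>

lemma bilinear_form_bump_bound:
  fixes J :: "real ^ 'n \<Rightarrow> real ^ 'n \<Rightarrow> real"
  assumes J: "admissible_kernel \<sigma> \<Lambda> J" and \<sigma>: "0 < \<sigma>" "\<sigma> < 2" and \<Lambda>: "0 < \<Lambda>"
  shows "\<exists>D>0. \<forall>R>0. \<forall>a\<ge>0. \<forall>v q. v \<in> borel_measurable lebesgue \<longrightarrow> integrable lebesgue q \<longrightarrow>
     (\<forall>x. 0 \<le> q x) \<longrightarrow> (\<forall>x. \<bar>v x\<bar> \<le> a + q x) \<longrightarrow>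
     \<bar>bilinear_form J v (\<lambda>x. bump (x /\<^sub>R R))\<bar>
       \<le> D * R powr (- \<sigma>) * (a * R ^ CARD('n) + (LINT x|lebesgue. q x))"
proof -
  obtain C where C: "0 < C"
    and C2: "\<And>x z :: real ^ 'n. \<bar>2 * bump x - bump (x + z) - bump (x - z)\<bar> \<le> C * min 1 ((norm z)\<^sup>2)"
    using bump_second_difference[where 'a = "real ^ 'n"] by blast
  define V where "V = unit_ball_vol (real CARD('n))"
  have V: "0 \<le> V" by (simp add: V_def)
  define L where "L = (real CARD('n) + \<sigma>) * V * (1 / (2 - \<sigma>) + 1 / \<sigma>)"
  have L: "0 \<le> L" using \<sigma> V by (simp add: L_def)
  \<comment> \<open>The summand 1 only serves to make \<open>D\<close> positive.\<close>
  define D where "D = \<Lambda> * C / 2 * (3 * (V + 1) * L) + 1"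
  have D: "0 < D" using \<Lambda> C V L by (simp add: D_def add_nonneg_pos)
  have "\<bar>bilinear_form J v (\<lambda>x. bump (x /\<^sub>R R))\<bar> \<le> D * R powr (- \<sigma>) * (a * R ^ CARD('n) + (LINT x|lebesgue. q x))"
    if R: "0 < R" and a: "0 \<le> a" and vm: "v \<in> borel_measurable lebesgue" and q: "integrable lebesgue q" "\<And>x. 0 \<le> q x"
      and v: "\<And>x. \<bar>v x\<bar> \<le> a + q x" for R a v q
  proof -
    let ?g = "\<lambda>x :: real ^ 'n. bump (x /\<^sub>R R)"
    let ?B = "cball 0 R :: (real ^ 'n) set"
    let ?w = "levy_weight (real CARD('n) + \<sigma>) R :: real ^ 'n \<Rightarrow> real"
    have B: "emeasure lborel ?B = ennreal (V * R ^ CARD('n))"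
      using emeasure_cball[of R "0 :: real ^ 'n"] R by (simp add: V_def)
    have K: "(\<integral>\<^sup>+ z. ennreal (?w z) \<partial>lborel) \<le> ennreal (L * R powr (- \<sigma>))"
      using nn_integral_levy_weight[OF \<sigma> R, where 'a = "real ^ 'n"] by (simp add: L_def V_def)
    have outside: "bump (x /\<^sub>R R) = 0" if "x \<notin> ?B" for x :: "real ^ 'n"
      using that R by (simp add: bump_eq_0_iff field_simps)
    have bump01: "0 \<le> bump x" "bump x \<le> 1" for x :: "real ^ 'n" by (rule bump_nonneg bump_le_1)+
    have g1: "\<bar>?g x - ?g y\<bar> \<le> indicator ?B x + indicator ?B y" for x y
      using bump01[of "x /\<^sub>R R"] bump01[of "y /\<^sub>R R"] outside[of x] outside[of y]
      by (auto simp: indicator_def abs_le_iff)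
    have g2: "\<bar>2 * ?g x - ?g y - ?g (2 *\<^sub>R x - y)\<bar> \<le> C * min 1 ((norm (y - x) / R)\<^sup>2) *
        (indicator ?B x + indicator ?B y + indicator ?B (2 *\<^sub>R x - y))" for x y
    proof (cases "x \<in> ?B \<or> y \<in> ?B \<or> 2 *\<^sub>R x - y \<in> ?B")
      case True
      have "x /\<^sub>R R + (y - x) /\<^sub>R R = y /\<^sub>R R" "x /\<^sub>R R - (y - x) /\<^sub>R R = (2 *\<^sub>R x - y) /\<^sub>R R"
        by (simp_all add: algebra_simps scaleR_2)
      then have "\<bar>2 * ?g x - ?g y - ?g (2 *\<^sub>R x - y)\<bar> \<le> C * min 1 ((norm ((y - x) /\<^sub>R R))\<^sup>2)"
        using C2[of "x /\<^sub>R R" "(y - x) /\<^sub>R R"] by simp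
      also have "norm ((y - x) /\<^sub>R R) = norm (y - x) / R" using R by (simp add: divide_inverse)
      also have "C * min 1 ((norm (y - x) / R)\<^sup>2) \<le> C * min 1 ((norm (y - x) / R)\<^sup>2) *
          (indicator ?B x + indicator ?B y + indicator ?B (2 *\<^sub>R x - y))"
        using True C mult_left_mono[of 1 "indicator ?B x + indicator ?B y + indicator ?B (2 *\<^sub>R x - y)"
            "C * min 1 ((norm (y - x) / R)\<^sup>2)"]
        by (auto simp: indicator_def)
      finally show ?thesis .
    next
      case False
      then show ?thesis using outside[of x] outside[of y] outside[of "2 *\<^sub>R x - y"] by simp
    qed
    have nn: "0 \<le> L * R powr (- \<sigma>)" "?B \<in> sets borel" "0 \<le> V * R ^ CARD('n)"
      using L V R by auto
    note G = kernel_integral_bound_real[OF q a levy_weight_measurable levy_weight_nonneg K nn(1,2) B nn(3)]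
    have "\<bar>bilinear_form J v ?g\<bar> \<le> \<Lambda> * C / 2 * (3 * (a * (V * R ^ CARD('n)) + (LINT x|lebesgue. q x)) * (L * R powr (- \<sigma>)))"
    proof (rule order_trans[OF bilinear_form_bound[OF J \<Lambda> R less_imp_le[OF C] vm v _ g1 g2 G(1)]])
      show "?g \<in> borel_measurable borel" by measurable
    qed (rule mult_left_mono[OF G(2)], use C \<Lambda> in simp)
    also have "\<dots> \<le> \<Lambda> * C / 2 * (3 * ((V + 1) * (a * R ^ CARD('n) + (LINT x|lebesgue. q x))) * (L * R powr (- \<sigma>)))"
    proof (intro mult_left_mono mult_right_mono)
      have "0 \<le> V * (LINT x|lebesgue. q x)" "0 \<le> a * R ^ CARD('n)" using q a R V by simp_all
      then show "a * (V * R ^ CARD('n)) + (LINT x|lebesgue. q x) \<le> (V + 1) * (a * R ^ CARD('n) + (LINT x|lebesgue. q x))"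
        by (simp add: algebra_simps)
    qed (use C \<Lambda> L in auto)
    also have "\<dots> = (D - 1) * (R powr (- \<sigma>) * (a * R ^ CARD('n) + (LINT x|lebesgue. q x)))"
      by (simp add: D_def)
    also have "\<dots> \<le> D * (R powr (- \<sigma>) * (a * R ^ CARD('n) + (LINT x|lebesgue. q x)))"
      using q a R by (intro mult_right_mono) auto
    finally show ?thesis by (simp only: mult.assoc)
  qed
  with D show ?thesis by blast
qed

section \<open>Critical growth\<close>

lemma powr_le_affine:
  fixes s l m :: real
  assumes "0 < l" "0 \<le> s" "0 < m" "m \<le> 1"
  shows "s powr m \<le> l powr m + l powr (m - 1) * s"
proof (cases "s \<le> l")
  case True
  then have "s powr m \<le> l powr m" using assms by (intro powr_mono2) auto
  then show ?thesis using assms by (simp add: add_increasing2)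
next
  case False
  have "s powr m = s powr (m - 1) * s powr 1" unfolding powr_add[symmetric] by simp
  also have "\<dots> = s powr (m - 1) * s" using False assms by simp
  also have "s powr (m - 1) \<le> l powr (m - 1)"
    using False assms by (intro powr_mono2') auto
  finally show ?thesis using assms by (simp add: add_increasing mult_right_mono)
qed

text \<open>
For a positive critical exponent \<open>m\<close>, the number \<open>\<bar>s\<bar> powr m\<close> is split at the level
\<open>l = k * R powr (- N)\<close>. As \<open>N * m = N - \<sigma>\<close>, all powers of \<open>R\<close> cancel in the coefficient of
\<open>\<bar>s\<bar>\<close>. If \<open>N \<le> \<sigma>\<close>, so that \<open>\<phi>\<close> is only known to be bounded, smallness comes from
continuity at the origin: \<open>\<bar>\<phi> s\<bar> \<le> \<epsilon>\<close> for small \<open>s\<close>, and the bounded remainder is absorbed by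
a multiple of \<open>\<bar>s\<bar>\<close>. This is what makes the borderline case \<open>N = \<sigma> = 1\<close> work.
\<close>

lemma nonlinearity_growth:
  fixes \<phi> :: "real \<Rightarrow> real"
  assumes \<sigma>: "0 < \<sigma>" and \<phi>: "admissible_nonlinearity \<phi>"
    and growth: "\<exists>C>0. \<forall>s. \<bar>\<phi> s\<bar> \<le>
           (if critical_exponent TYPE('n::finite) \<sigma> = 0 then C
            else C * \<bar>s\<bar> powr critical_exponent TYPE('n) \<sigma>)"
    and \<epsilon>: "0 < \<epsilon>"
  shows "\<exists>K\<ge>0. \<forall>R\<ge>1. \<forall>s. R powr (- \<sigma>) * \<bar>\<phi> s\<bar> \<le> \<epsilon> * R powr (- real CARD('n)) + K * \<bar>s\<bar>"
proof -
  let ?N = "real CARD('n)"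
  define m where "m = critical_exponent TYPE('n) \<sigma>"
  have N: "0 < ?N" by simp
  from growth obtain C where C: "0 < C" and CC: "\<And>s. \<bar>\<phi> s\<bar> \<le> (if m = 0 then C else C * \<bar>s\<bar> powr m)"
    unfolding m_def by blast
  show ?thesis
  proof (cases "?N \<le> \<sigma>")
    case True
    then have "m = 0" by (simp add: m_def critical_exponent_def)
    then have bd: "\<bar>\<phi> s\<bar> \<le> C" for s using CC[of s] by simp
    from \<phi> have c1: "continuous_on {0..} \<phi>" and c2: "continuous_on {0..} (\<lambda>s. - \<phi> (- s))" and z: "\<phi> 0 = 0"
      by (simp_all add: admissible_nonlinearity_def nonlinearity_class_def)
    obtain d1 where d1: "0 < d1" "\<And>s. 0 \<le> s \<Longrightarrow> s < d1 \<Longrightarrow> \<bar>\<phi> s\<bar> < \<epsilon>"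
      using c1[unfolded continuous_on_iff, rule_format, of 0 \<epsilon>] \<epsilon> z by (auto simp: dist_real_def)
    obtain d2 where d2: "0 < d2" "\<And>s. 0 \<le> s \<Longrightarrow> s < d2 \<Longrightarrow> \<bar>\<phi> (- s)\<bar> < \<epsilon>"
      using c2[unfolded continuous_on_iff, rule_format, of 0 \<epsilon>] \<epsilon> z by (auto simp: dist_real_def)
    define d where "d = min d1 d2"
    have d: "0 < d" using d1(1) d2(1) by (simp add: d_def)
    have small: "\<bar>\<phi> s\<bar> \<le> \<epsilon> + C / d * \<bar>s\<bar>" for s
    proof (cases "\<bar>s\<bar> < d")
      case True
      then have "\<bar>\<phi> s\<bar> < \<epsilon>"
        using d1(2)[of s] d2(2)[of "- s"] by (cases "0 \<le> s") (auto simp: d_def)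
      then show ?thesis using C d by (intro add_increasing2) auto
    next
      case False
      then have "C * 1 \<le> C * (\<bar>s\<bar> / d)" using C d by (intro mult_left_mono) (auto simp: field_simps)
      then show ?thesis using bd[of s] \<epsilon> by simp
    qed
    have "R powr (- \<sigma>) * \<bar>\<phi> s\<bar> \<le> \<epsilon> * R powr (- ?N) + C / d * \<bar>s\<bar>" if R: "1 \<le> R" for R s
    proof -
      have "R powr (- \<sigma>) * \<bar>\<phi> s\<bar> \<le> R powr (- \<sigma>) * (\<epsilon> + C / d * \<bar>s\<bar>)"
        by (intro mult_left_mono small) simp
      also have "\<dots> = \<epsilon> * R powr (- \<sigma>) + R powr (- \<sigma>) * (C / d * \<bar>s\<bar>)" by (simp add: distrib_left)
      also have "\<epsilon> * R powr (- \<sigma>) \<le> \<epsilon> * R powr (- ?N)"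
        using True R \<epsilon> by (intro mult_left_mono powr_mono) auto
      also have "R powr (- \<sigma>) * (C / d * \<bar>s\<bar>) \<le> 1 * (C / d * \<bar>s\<bar>)"
        using R \<sigma> C d powr_mono[of "- \<sigma>" 0 R] by (intro mult_right_mono) auto
      finally show ?thesis by simp
    qed
    then show ?thesis using C d by (intro exI[of _ "C / d"]) auto
  next
    case False
    then have m: "m = (?N - \<sigma>) / ?N" by (simp add: m_def critical_exponent_def)
    have m0: "0 < m" and m1: "m \<le> 1" using False \<sigma> by (simp_all add: m field_simps)
    have Nm: "?N * m = ?N - \<sigma>" using N by (simp add: m)
    have bd: "\<bar>\<phi> s\<bar> \<le> C * \<bar>s\<bar> powr m" for s using CC[of s] m0 by simp
    define k where "k = (\<epsilon> / C) powr (1 / m)"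
    have k: "0 < k" "C * k powr m = \<epsilon>"
      using \<epsilon> C m0 by (simp_all add: k_def powr_powr)
    have "R powr (- \<sigma>) * \<bar>\<phi> s\<bar> \<le> \<epsilon> * R powr (- ?N) + C * k powr (m - 1) * \<bar>s\<bar>" if R: "1 \<le> R" for R s
    proof -
      let ?l = "k * R powr (- ?N)"
      have l: "0 < ?l" using k R by simp
      have lp: "?l powr b = k powr b * R powr (- ?N * b)" for b
        using k R by (simp add: powr_mult powr_powr)
      have "\<bar>\<phi> s\<bar> \<le> C * (?l powr m + ?l powr (m - 1) * \<bar>s\<bar>)"
        using bd[of s] mult_left_mono[OF powr_le_affine[OF l, of "\<bar>s\<bar>" m], of C] m0 m1 C by linarith
      then have "R powr (- \<sigma>) * \<bar>\<phi> s\<bar> \<le> R powr (- \<sigma>) * (C * (?l powr m + ?l powr (m - 1) * \<bar>s\<bar>))"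
        by (intro mult_left_mono) auto
      also have "\<dots> = C * k powr m * (R powr (- \<sigma>) * R powr (- ?N * m))
          + C * k powr (m - 1) * (R powr (- \<sigma>) * R powr (- ?N * (m - 1))) * \<bar>s\<bar>"
        unfolding lp by (simp only: algebra_simps)
      also have "R powr (- \<sigma>) * R powr (- ?N * m) = R powr (- ?N)"
        unfolding powr_add[symmetric] using Nm by simp
      also have "R powr (- \<sigma>) * R powr (- ?N * (m - 1)) = 1"
        unfolding powr_add[symmetric] using Nm R by (simp add: algebra_simps)
      finally show ?thesis using k by simp
    qed
    then show ?thesis using C k by (intro exI[of _ "C * k powr (m - 1)"]) auto
  qed
qed

text \<open>
The choice \<open>\<epsilon> = 1\<close> in the growth bound gives a bound uniform in \<open>R\<close>, which serves as
dominating function in time. Here \<open>\<Phi> R v\<close> stands for the form of \<open>v\<close> against the bump of radius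
\<open>R\<close>.
\<close>

lemma forms_bounded:
  fixes \<Phi> :: "real \<Rightarrow> ('a::euclidean_space \<Rightarrow> real) \<Rightarrow> real"
  assumes D: "0 < D" and \<Phi>: "\<And>R a v q. 0 < R \<Longrightarrow> 0 \<le> a \<Longrightarrow> v \<in> borel_measurable lebesgue \<Longrightarrow>
      integrable lebesgue q \<Longrightarrow> (\<And>x. 0 \<le> q x) \<Longrightarrow> (\<And>x. \<bar>v x\<bar> \<le> a + q x) \<Longrightarrow>
      \<bar>\<Phi> R v\<bar> \<le> D * R powr (- \<sigma>) * (a * R ^ N + (LINT x|lebesgue. q x))"
    and K: "0 \<le> K" "\<And>R s. 1 \<le> R \<Longrightarrow> R powr (- \<sigma>) * \<bar>\<phi> s\<bar> \<le> R powr (- real N) + K * \<bar>s\<bar>"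
    and w: "integrable lebesgue w" and v: "(\<lambda>x. \<phi> (w x)) \<in> borel_measurable lebesgue" and R: "1 \<le> R"
  shows "\<bar>\<Phi> R (\<lambda>x. \<phi> (w x))\<bar> \<le> D * (1 + K * (LINT x|lebesgue. \<bar>w x\<bar>))"
proof -
  have 1: "R powr (- \<sigma>) * R powr \<sigma> = 1"
    using R by (simp flip: powr_add)
  have 2: "R powr (- real N) * R ^ N = 1"
    using R by (simp flip: powr_realpow add: powr_add[symmetric])
  have "\<bar>\<phi> (w x)\<bar> \<le> R powr \<sigma> * R powr (- real N) + R powr \<sigma> * K * \<bar>w x\<bar>" for x
  proof -
    have "\<bar>\<phi> (w x)\<bar> = R powr \<sigma> * (R powr (- \<sigma>) * \<bar>\<phi> (w x)\<bar>)"
      using 1 by (simp flip: mult.assoc) (simp add: mult.commute)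
    also have "\<dots> \<le> R powr \<sigma> * (R powr (- real N) + K * \<bar>w x\<bar>)"
      by (intro mult_left_mono K R) simp
    finally show ?thesis by (simp add: distrib_left)
  qed
  with \<Phi>[OF _ _ v, of R "R powr \<sigma> * R powr (- real N)" "\<lambda>x. R powr \<sigma> * K * \<bar>w x\<bar>"] w K R
  have "\<bar>\<Phi> R (\<lambda>x. \<phi> (w x))\<bar>
      \<le> D * R powr (- \<sigma>) * (R powr \<sigma> * R powr (- real N) * R ^ N + R powr \<sigma> * K * (LINT x|lebesgue. \<bar>w x\<bar>))"
    by simp
  also have "\<dots> = D * ((R powr (- \<sigma>) * R powr \<sigma>) * (R powr (- real N) * R ^ N)
      + (R powr (- \<sigma>) * R powr \<sigma>) * (K * (LINT x|lebesgue. \<bar>w x\<bar>)))"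
    by (simp only: algebra_simps)
  finally show ?thesis unfolding 1 2 by simp
qed

text \<open>
The growth bound alone only gives \<open>D * (\<epsilon> + K * \<integral> \<bar>w\<bar>)\<close> with \<open>K\<close> depending on \<open>\<epsilon>\<close>. Subtracting
the constant part first leaves a remainder \<open>r n\<close> that is dominated by \<open>K * \<bar>w\<bar>\<close> and tends to zero
pointwise, so that its integral can be made small after \<open>\<epsilon>\<close> has been fixed.
\<close>

lemma forms_tendsto_zero:
  fixes \<Phi> :: "real \<Rightarrow> ('a::euclidean_space \<Rightarrow> real) \<Rightarrow> real"
  assumes D: "0 < D" and \<Phi>: "\<And>R a v q. 0 < R \<Longrightarrow> 0 \<le> a \<Longrightarrow> v \<in> borel_measurable lebesgue \<Longrightarrow>
      integrable lebesgue q \<Longrightarrow> (\<And>x. 0 \<le> q x) \<Longrightarrow> (\<And>x. \<bar>v x\<bar> \<le> a + q x) \<Longrightarrow>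
      \<bar>\<Phi> R v\<bar> \<le> D * R powr (- \<sigma>) * (a * R ^ N + (LINT x|lebesgue. q x))"
    and K: "\<And>\<epsilon>. 0 < \<epsilon> \<Longrightarrow> \<exists>K\<ge>0. \<forall>R\<ge>1. \<forall>s. R powr (- \<sigma>) * \<bar>\<phi> s\<bar> \<le> \<epsilon> * R powr (- real N) + K * \<bar>s\<bar>"
    and \<sigma>: "0 < \<sigma>"
    and w: "integrable lebesgue w" and v: "(\<lambda>x. \<phi> (w x)) \<in> borel_measurable lebesgue"
  shows "(\<lambda>n. \<Phi> (real n + 1) (\<lambda>x. \<phi> (w x))) \<longlonglongrightarrow> 0"
proof (rule LIMSEQ_I)
  fix e :: real assume e: "0 < e"
  define \<epsilon> where "\<epsilon> = e / (2 * D)"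
  have \<epsilon>: "0 < \<epsilon>" using e D by (simp add: \<epsilon>_def)
  obtain K where K: "0 \<le> K" "\<And>R s. 1 \<le> R \<Longrightarrow> R powr (- \<sigma>) * \<bar>\<phi> s\<bar> \<le> \<epsilon> * R powr (- real N) + K * \<bar>s\<bar>"
    using K[OF \<epsilon>] by blast
  define r where "r n x = max 0 ((real n + 1) powr (- \<sigma>) * \<bar>\<phi> (w x)\<bar> - \<epsilon> * (real n + 1) powr (- real N))" for n x
  have r0: "0 \<le> r n x" for n x by (simp add: r_def)
  have rK: "r n x \<le> K * \<bar>w x\<bar>" for n x
    using K(2)[of "real n + 1" "w x"] K(1) by (simp add: r_def)
  have rm: "r n \<in> borel_measurable lebesgue" for n
    unfolding r_def[abs_def] using v by (intro borel_measurable_max borel_measurable_diff borel_measurable_times) auto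
  have Kw: "integrable lebesgue (\<lambda>x. K * \<bar>w x\<bar>)" using w by simp
  have ri: "integrable lebesgue (r n)" for n
    by (rule Bochner_Integration.integrable_bound[OF Kw rm]) (use r0 rK K in auto)
  have Rlim: "(\<lambda>n. (real n + 1) powr (- \<sigma>)) \<longlonglongrightarrow> 0"
  proof (rule tendsto_neg_powr)
    show "filterlim (\<lambda>n. real n + 1) at_top sequentially"
      by (rule filterlim_at_top_mono[OF filterlim_real_sequentially]) auto
  qed (use \<sigma> in simp)
  have "(\<lambda>n. LINT x|lebesgue. r n x) \<longlonglongrightarrow> (LINT x::'a|lebesgue. 0)"
  proof (rule integral_dominated_convergence[OF _ rm Kw])
    show "AE x in lebesgue. norm (r n x) \<le> K * \<bar>w x\<bar>" for n
      using r0 rK by simp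
    show "AE x in lebesgue. (\<lambda>n. r n x) \<longlonglongrightarrow> 0"
    proof (rule AE_I2)
      fix x
      have lim: "(\<lambda>n. (real n + 1) powr (- \<sigma>) * \<bar>\<phi> (w x)\<bar>) \<longlonglongrightarrow> 0"
        using tendsto_mult_right[OF Rlim, of "\<bar>\<phi> (w x)\<bar>"] by (simp add: mult.commute)
      show "(\<lambda>n. r n x) \<longlonglongrightarrow> 0"
        by (rule tendsto_sandwich[OF _ _ tendsto_const lim]) (use \<epsilon> in \<open>auto simp: r_def\<close>)
    qed
  qed simp
  then have "\<forall>\<^sub>F n in sequentially. (LINT x|lebesgue. r n x) < \<epsilon>"
    using \<epsilon> by (intro order_tendstoD) auto
  then obtain n0 where n0: "\<And>n. n0 \<le> n \<Longrightarrow> (LINT x|lebesgue. r n x) < \<epsilon>"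
    by (auto simp: eventually_sequentially)
  have "norm (\<Phi> (real n + 1) (\<lambda>x. \<phi> (w x)) - 0) < e" if "n0 \<le> n" for n
  proof -
    let ?R = "real n + 1"
    have 1: "?R powr (- \<sigma>) * ?R powr \<sigma> = 1"
      by (simp flip: powr_add)
    have 2: "?R powr (- real N) * ?R ^ N = 1"
      by (simp flip: powr_realpow add: powr_add[symmetric])
    have "\<bar>\<phi> (w x)\<bar> \<le> ?R powr \<sigma> * (\<epsilon> * ?R powr (- real N)) + ?R powr \<sigma> * r n x" for x
    proof -
      have "\<bar>\<phi> (w x)\<bar> = ?R powr \<sigma> * (?R powr (- \<sigma>) * \<bar>\<phi> (w x)\<bar>)"
        using 1 by (simp flip: mult.assoc) (simp add: mult.commute)
      also have "\<dots> \<le> ?R powr \<sigma> * (\<epsilon> * ?R powr (- real N) + r n x)"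
        by (intro mult_left_mono) (auto simp: r_def)
      finally show ?thesis by (simp add: distrib_left)
    qed
    with \<Phi>[OF _ _ v, of ?R "?R powr \<sigma> * (\<epsilon> * ?R powr (- real N))" "\<lambda>x. ?R powr \<sigma> * r n x"] ri r0 \<epsilon>
    have "\<bar>\<Phi> ?R (\<lambda>x. \<phi> (w x))\<bar>
        \<le> D * ?R powr (- \<sigma>) * (?R powr \<sigma> * (\<epsilon> * ?R powr (- real N)) * ?R ^ N + ?R powr \<sigma> * (LINT x|lebesgue. r n x))"
      by simp
    also have "\<dots> = D * ((?R powr (- \<sigma>) * ?R powr \<sigma>) * \<epsilon> * (?R powr (- real N) * ?R ^ N)
        + (?R powr (- \<sigma>) * ?R powr \<sigma>) * (LINT x|lebesgue. r n x))"
      by (simp only: algebra_simps)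
    also have "\<dots> = D * (\<epsilon> + (LINT x|lebesgue. r n x))" unfolding 1 2 by simp
    also have "\<dots> < D * (\<epsilon> + \<epsilon>)" using n0[OF that] D by simp
    also have "\<dots> = e" using D by (simp add: \<epsilon>_def)
    finally show ?thesis by simp
  qed
  then show "\<exists>n0. \<forall>n\<ge>n0. norm (\<Phi> (real n + 1) (\<lambda>x. \<phi> (w x)) - 0) < e" by blast
qed

section \<open>Test functions\<close>

text \<open>
The two bumps have the same integral, so an antiderivative of their difference is constant on both
sides and can be normalised to have compact support.
\<close>

lemma Ck_antiderivative_difference:
  fixes a b d :: real
  assumes d: "0 < d"
  shows "\<exists>\<eta>. (\<forall>k. Ck k \<eta>) \<and>
    (\<forall>t. (\<eta> has_real_derivative (bump ((t - a) / d) - bump ((t - b) / d))) (at t)) \<and>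
    (\<forall>t. t \<notin> {min a b - d..max a b + d} \<longrightarrow> \<eta> t = 0)"
proof -
  have "isCont (bump :: real \<Rightarrow> real) x" for x
    using continuous_bump[of "UNIV :: real set"] by (simp add: continuous_on_eq_continuous_at)
  then obtain P :: "real \<Rightarrow> real" where "\<And>x. (P has_vector_derivative bump x) (at x)"
    using einterval_antiderivative[of "-\<infinity>" "\<infinity>" "bump :: real \<Rightarrow> real"] by auto
  then have P: "(P has_real_derivative bump x) (at x)" for x
    by (simp add: has_real_derivative_iff_has_vector_derivative)
  define \<eta> where "\<eta> t = d * (P ((t - a) / d) - P ((t - b) / d))" for t
  have der: "(\<eta> has_real_derivative (bump ((t - a) / d) - bump ((t - b) / d))) (at t)" for t
    unfolding \<eta>_def using d
    by (auto intro!: derivative_eq_intros DERIV_chain'[OF _ P] simp: field_simps)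
  have Ck': "Ck k (\<lambda>t. bump ((t - c) / d))" for k c
  proof -
    have "Ck k (\<lambda>t. bump (t / d + (- c / d)))"
      by (rule Ck_affine_comp[OF bounded_linear_divide Ck_bump])
    then show ?thesis by (simp add: diff_divide_distrib)
  qed
  have "Ck k (\<lambda>t. bump ((t - a) / d) + (-1) * bump ((t - b) / d))" for k
    by (intro Ck_add Ck_mult Ck_const Ck')
  then have "Ck (Suc k) \<eta>" for k
    by (intro Ck_real_SucI[OF der]) simp
  then have Ck: "Ck k \<eta>" for k by (rule Ck_mono)
  have left: "P x = P (-1)" if "x \<le> -1" for x
  proof -
    have "\<exists>c. \<forall>y\<in>{..-1}. P y = c"
    proof (rule has_field_derivative_zero_constant)
      fix y :: real
      assume "y \<in> {..-1}"
      then have "bump y = 0" using bump_eq_0_iff[of y] by auto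
      then show "(P has_field_derivative 0) (at y within {..-1})"
        using P[of y] by (simp add: has_field_derivative_at_within)
    qed simp
    then show ?thesis using that by force
  qed
  have right: "P x = P 1" if "1 \<le> x" for x
  proof -
    have "\<exists>c. \<forall>y\<in>{1..}. P y = c"
    proof (rule has_field_derivative_zero_constant)
      fix y :: real
      assume "y \<in> {1..}"
      then have "bump y = 0" using bump_eq_0_iff[of y] by auto
      then show "(P has_field_derivative 0) (at y within {1..})"
        using P[of y] by (simp add: has_field_derivative_at_within)
    qed simp
    then show ?thesis using that by force
  qed
  have zero: "\<eta> t = 0" if "t \<notin> {min a b - d..max a b + d}" for t
  proof (cases "t < min a b - d")
    case True
    then have "(t - a) / d \<le> -1" "(t - b) / d \<le> -1" using d by (auto simp: field_simps)
    then show ?thesis using left[of "(t - a) / d"] left[of "(t - b) / d"] by (simp add: \<eta>_def)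
  next
    case False
    then have "1 \<le> (t - a) / d" "1 \<le> (t - b) / d" using d that by (auto simp: field_simps)
    then show ?thesis using right[of "(t - a) / d"] right[of "(t - b) / d"] by (simp add: \<eta>_def)
  qed
  show ?thesis using Ck der zero by blast
qed

lemma product_test_function:
  fixes \<eta> :: "real \<Rightarrow> real"
  assumes \<eta>: "\<And>k. Ck k \<eta>" and zero: "\<And>t. t \<notin> {\<alpha>..\<beta>} \<Longrightarrow> \<eta> t = 0" and \<alpha>: "0 < \<alpha>" and R: "0 < R"
  shows "test_function (\<lambda>p :: (real ^ 'n) \<times> real. bump (fst p /\<^sub>R R) * \<eta> (snd p))"
    (is "test_function ?\<zeta>")
proof -
  have "Ck k (\<lambda>p :: (real ^ 'n) \<times> real. bump (fst p /\<^sub>R R + 0))" for k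
    by (rule Ck_affine_comp[OF _ Ck_bump]) (intro bounded_linear_const_scaleR bounded_linear_fst)
  moreover have "Ck k (\<lambda>p :: (real ^ 'n) \<times> real. \<eta> (snd p + 0))" for k
    by (rule Ck_affine_comp[OF bounded_linear_snd \<eta>])
  ultimately have Ck: "Ck k ?\<zeta>" for k by (intro Ck_mult) simp_all
  let ?K = "cball (0 :: real ^ 'n) R \<times> {\<alpha>..\<beta>}"
  have K: "compact ?K" by (intro compact_Times) auto
  have "{p. ?\<zeta> p \<noteq> 0} \<subseteq> ?K"
  proof
    fix p :: "(real ^ 'n) \<times> real"
    assume "p \<in> {p. ?\<zeta> p \<noteq> 0}"
    then have "bump (fst p /\<^sub>R R) \<noteq> 0" "\<eta> (snd p) \<noteq> 0" by auto
    then have "norm (fst p) \<le> R" "snd p \<in> {\<alpha>..\<beta>}"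
      using zero R by (auto simp: bump_eq_0_iff field_simps)
    then show "p \<in> ?K" by (cases p) auto
  qed
  then have sub: "closure {p. ?\<zeta> p \<noteq> 0} \<subseteq> ?K"
    using K by (intro closure_minimal compact_imp_closed)
  moreover have "compact (closure {p. ?\<zeta> p \<noteq> 0})"
  proof -
    have "compact (?K \<inter> closure {p. ?\<zeta> p \<noteq> 0})" by (rule compact_Int_closed[OF K closed_closure])
    then show ?thesis by (simp only: Int_absorb1[OF sub])
  qed
  moreover have "?K \<subseteq> space_time" using \<alpha> by (auto simp: space_time_def)
  ultimately show ?thesis using Ck by (auto simp: test_function_def)
qed

section \<open>Functions of time\<close>

lemma continuous_L1_functional:
  assumes u: "continuous_L1 u" and f: "\<And>t. 0 \<le> t \<Longrightarrow> integrable lebesgue (f t)"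
    and le: "\<And>s t x. \<bar>f t x - f s x\<bar> \<le> \<bar>u t x - u s x\<bar>"
  shows "continuous_on {0..} (\<lambda>t. LINT x|lebesgue. f t x :: real)"
proof (unfold continuous_on_def, intro ballI)
  fix s :: real assume s: "s \<in> {0..}"
  have lim: "((\<lambda>t. LINT x|lebesgue. \<bar>u t x - u s x\<bar>) \<longlongrightarrow> 0) (at s within {0..})"
    using u s by (simp add: continuous_L1_def)
  have ui: "0 \<le> t \<Longrightarrow> integrable lebesgue (u t)" for t using u by (simp add: continuous_L1_def)
  have "((\<lambda>t. (LINT x|lebesgue. f t x) - (LINT x|lebesgue. f s x)) \<longlongrightarrow> 0) (at s within {0..})"
  proof (rule Lim_null_comparison[OF _ lim])
    show "\<forall>\<^sub>F t in at s within {0..}. norm ((LINT x|lebesgue. f t x) - (LINT x|lebesgue. f s x))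
        \<le> (LINT x|lebesgue. \<bar>u t x - u s x\<bar>)"
      unfolding eventually_at_filter
    proof (rule always_eventually, intro allI impI)
      fix t :: real assume "t \<noteq> s" "t \<in> {0..}"
      then have t: "0 \<le> t" by simp
      have "norm ((LINT x|lebesgue. f t x) - (LINT x|lebesgue. f s x)) = \<bar>LINT x|lebesgue. f t x - f s x\<bar>"
        using f t s by simp
      also have "\<dots> \<le> (LINT x|lebesgue. \<bar>u t x - u s x\<bar>)"
        using f ui t s le by (intro integral_abs_bound_integral) auto
      finally show "norm ((LINT x|lebesgue. f t x) - (LINT x|lebesgue. f s x)) \<le> (LINT x|lebesgue. \<bar>u t x - u s x\<bar>)" .
    qed
  qed
  then show "((\<lambda>t. LINT x|lebesgue. f t x) \<longlongrightarrow> (LINT x|lebesgue. f s x)) (at s within {0..})"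
    by (simp add: LIM_zero_iff)
qed

text \<open>
Dominated convergence to 0 without measurability of the \<open>b n\<close>: a function that is not
integrable has integral 0. This avoids proving that the bilinear form depends measurably on time.
\<close>

lemma integral_dominated_null:
  fixes b :: "nat \<Rightarrow> 'a \<Rightarrow> real"
  assumes w: "integrable M w" and le: "\<And>n. AE t in M. \<bar>b n t\<bar> \<le> w t"
    and lim: "AE t in M. (\<lambda>n. b n t) \<longlonglongrightarrow> 0"
  shows "(\<lambda>n. LINT t|M. b n t) \<longlonglongrightarrow> 0"
proof -
  define b' where "b' n = (if integrable M (b n) then b n else (\<lambda>_. 0))" for n
  have eq: "(LINT t|M. b n t) = (LINT t|M. b' n t)" for n
    by (simp add: b'_def not_integrable_integral_eq)
  have "(\<lambda>n. LINT t|M. b' n t) \<longlonglongrightarrow> (LINT t|M. 0)"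
  proof (rule integral_dominated_convergence[OF _ _ w])
    show "b' n \<in> borel_measurable M" for n by (auto simp: b'_def)
    show "AE t in M. norm (b' n t) \<le> w t" for n
      using le[of n] by eventually_elim (auto simp: b'_def)
    show "AE t in M. (\<lambda>n. b' n t) \<longlonglongrightarrow> 0"
      using lim
    proof eventually_elim
      case (elim t)
      show ?case
        by (rule Lim_null_comparison[OF _ tendsto_rabs_zero[OF elim]]) (auto simp: b'_def)
    qed
  qed simp
  then show ?thesis by (simp add: eq)
qed

lemma bump_integral_positive: "0 < (LINT s|lborel. bump (s::real))"
proof -
  have eq: "(\<lambda>s::real. indicator {-1..1} s *\<^sub>R bump s) = bump"
  proof
    fix s :: real
    show "indicator {-1..1} s *\<^sub>R bump s = bump s"
      using bump_eq_0_iff[of s] by (cases "s \<in> {-1..1}") auto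
  qed
  have i: "integrable lborel (bump :: real \<Rightarrow> real)"
    using borel_integrable_compact[of "{-1..1}" "bump :: real \<Rightarrow> real", OF _ continuous_bump]
    unfolding eq by simp
  show "0 < (LINT s|lborel. bump (s::real))"
  proof (rule ccontr)
    assume "\<not> 0 < (LINT s|lborel. bump (s::real))"
    moreover have "0 \<le> (LINT s|lborel. bump (s::real))" by (simp add: bump_nonneg)
    ultimately have "(LINT s|lborel. bump (s::real)) = 0" by simp
    then have "AE s in lborel. bump (s::real) = 0"
      using integral_nonneg_eq_0_iff_AE[OF i] bump_nonneg by auto
    then have "AE s in lborel. \<not> (s \<in> {-1<..<1::real})"
      by eventually_elim (auto simp: bump_eq_0_iff)
    then have "{-1<..<1::real} \<in> null_sets lborel"
      by (subst AE_iff_null_sets) auto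
    then show False by (simp add: null_sets_def)
  qed
qed

text \<open>
Substituting \<open>t = a + d * s\<close> turns the averages into integrals of \<open>bump s * M (a + d * s)\<close>,
whose limit as \<open>d\<close> tends to 0 is \<open>M a\<close> times the positive integral of \<open>bump\<close>.
\<close>

lemma continuous_eq_from_mollified:
  fixes M :: "real \<Rightarrow> real"
  assumes M: "continuous_on {0..} M" and a: "0 < a" and b: "0 < b"
    and zero: "\<And>d. 0 < d \<Longrightarrow> d < a \<Longrightarrow> d < b \<Longrightarrow>
      (LINT t|lebesgue. indicator {0<..} t * ((bump ((t - a) / d) - bump ((t - b) / d)) * M t)) = 0"
  shows "M a = M b"
proof -
  define g where "g t = indicator {0<..} t *\<^sub>R M t" for t
  have gm[measurable]: "g \<in> borel_measurable borel"
    unfolding g_def[abs_def]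
    by (rule borel_measurable_continuous_on_indicator) (auto intro: continuous_on_subset[OF M])
  have gc: "isCont g t" if "0 < t" for t
  proof -
    have "continuous_on {0<..} M" by (rule continuous_on_subset[OF M]) auto
    then have "continuous_on {0<..} g" by (rule continuous_on_eq) (auto simp: g_def)
    then show ?thesis using that by (simp add: continuous_on_eq_continuous_at)
  qed
  \<comment> \<open>These widths keep all arguments \<open>c + d n * s\<close> with \<open>\<bar>s\<bar> \<le> 1\<close> inside the compact interval from \<open>c / 2\<close> to \<open>2 * c\<close>.\<close>
  define d where "d n = min a b / (real n + 2)" for n :: nat
  have d: "0 < d n" "d n \<le> a / 2" "d n \<le> b / 2" for n
  proof -
    show "0 < d n" using a b by (simp add: d_def)
    have "d n \<le> min a b / 2" unfolding d_def using a b by (intro divide_left_mono) auto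
    then show "d n \<le> a / 2" "d n \<le> b / 2" by auto
  qed
  have dlim: "d \<longlonglongrightarrow> 0"
    unfolding d_def by (intro tendsto_divide_0[OF tendsto_const] filterlim_at_top_imp_at_infinity
        filterlim_at_top_mono[OF filterlim_real_sequentially]) auto
  have gb: "\<exists>A. \<forall>n. \<forall>s. \<bar>bump s * g (c + d n * s)\<bar> \<le> indicator {-1..1} s * A"
    if c: "0 < c" "\<And>n. d n \<le> c / 2" for c
  proof -
    have "compact (g ` {c / 2..2 * c})"
      using c gc by (intro compact_continuous_image continuous_at_imp_continuous_on) auto
    then obtain A where A: "\<And>t. t \<in> {c / 2..2 * c} \<Longrightarrow> \<bar>g t\<bar> \<le> A"
      by (metis compact_imp_bounded bounded_iff image_eqI real_norm_def)
    have "\<bar>bump s * g (c + d n * s)\<bar> \<le> indicator {-1..1} s * A" for n s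
    proof (cases "\<bar>s\<bar> \<le> 1")
      case True
      have "\<bar>d n * s\<bar> \<le> (c / 2) * 1"
        unfolding abs_mult using True d(1)[of n] c by (intro mult_mono) auto
      then have "\<bar>g (c + d n * s)\<bar> \<le> A" using c by (intro A) auto
      then have "bump s * \<bar>g (c + d n * s)\<bar> \<le> 1 * A"
        using bump_nonneg[of s] bump_le_1[of s] by (intro mult_mono) auto
      then show ?thesis using True bump_nonneg[of s] by (simp add: abs_mult abs_le_iff indicator_def)
    next
      case False
      then show ?thesis using bump_eq_0_iff[of s] by (auto simp: indicator_def)
    qed
    then show ?thesis by blast
  qed
  have conv: "(\<lambda>n. LINT s|lborel. bump s * g (c + d n * s)) \<longlonglongrightarrow> (LINT s::real|lborel. bump s * g c)"
    and int: "integrable lborel (\<lambda>s. bump s * g (c + d n * s))"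
    if c: "0 < c" "\<And>n. d n \<le> c / 2" for c n
  proof -
    obtain A where A: "\<And>n s. \<bar>bump s * g (c + d n * s)\<bar> \<le> indicator {-1..1} s * A"
      using gb[OF c] by blast
    have w: "integrable lborel (\<lambda>s. indicator {-1..1::real} s * A)"
      by (intro integrable_mult_left) simp
    have m: "(\<lambda>s. bump s * g (c + d n * s)) \<in> borel_measurable lborel" for n by measurable
    show "integrable lborel (\<lambda>s. bump s * g (c + d n * s))"
      by (rule Bochner_Integration.integrable_bound[OF w m])
         (use A in \<open>auto intro!: AE_I2 order_trans[OF _ abs_ge_self]\<close>)
    show "(\<lambda>n. LINT s|lborel. bump s * g (c + d n * s)) \<longlonglongrightarrow> (LINT s::real|lborel. bump s * g c)"
    proof (rule integral_dominated_convergence[OF _ m w])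
      show "(\<lambda>s::real. bump s * g c) \<in> borel_measurable lborel" by measurable
      show "AE s in lborel. norm (bump s * g (c + d n * s)) \<le> indicator {-1..1} s * A" for n
        using A by simp
      show "AE s in lborel. (\<lambda>n. bump s * g (c + d n * s)) \<longlonglongrightarrow> bump s * g c"
      proof (rule AE_I2)
        fix s :: real
        have "(\<lambda>n. c + d n * s) \<longlonglongrightarrow> c + 0 * s" by (intro tendsto_intros dlim)
        then have "(\<lambda>n. c + d n * s) \<longlonglongrightarrow> c" by simp
        then show "(\<lambda>n. bump s * g (c + d n * s)) \<longlonglongrightarrow> bump s * g c"
          by (intro tendsto_mult tendsto_const isCont_tendsto_compose[OF gc[OF c(1)]])
      qed
    qed
  qed
  have subst: "(LINT t|lborel. bump ((t - c) / d n) * g t) = d n * (LINT s|lborel. bump s * g (c + d n * s))"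
    and int': "integrable lborel (\<lambda>t. bump ((t - c) / d n) * g t)"
    if c: "0 < c" "\<And>n. d n \<le> c / 2" for c n
  proof -
    show "(LINT t|lborel. bump ((t - c) / d n) * g t) = d n * (LINT s|lborel. bump s * g (c + d n * s))"
      using lborel_integral_real_affine[of "d n" "\<lambda>t. bump ((t - c) / d n) * g t" c] d(1)[of n]
      by (simp add: less_imp_neq[THEN not_sym])
    show "integrable lborel (\<lambda>t. bump ((t - c) / d n) * g t)"
      using lborel_integrable_real_affine_iff[of "d n" "\<lambda>t. bump ((t - c) / d n) * g t" c] d(1)[of n] int[OF c, of n]
      by (simp add: less_imp_neq[THEN not_sym])
  qed
  have eq: "(LINT s|lborel. bump s * g (a + d n * s)) = (LINT s|lborel. bump s * g (b + d n * s))" for n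
  proof -
    have "(LINT t|lebesgue. bump ((t - a) / d n) * g t - bump ((t - b) / d n) * g t)
        = (LINT t|lebesgue. indicator {0<..} t * ((bump ((t - a) / d n) - bump ((t - b) / d n)) * M t))"
      by (rule Bochner_Integration.integral_cong) (auto simp: g_def indicator_def algebra_simps)
    also have "\<dots> = 0"
      using d(1)[of n] d(2)[of n] d(3)[of n] a b by (intro zero) linarith+
    also have "(LINT t|lebesgue. bump ((t - a) / d n) * g t - bump ((t - b) / d n) * g t)
        = (LINT t|lborel. bump ((t - a) / d n) * g t - bump ((t - b) / d n) * g t)"
      by (rule integral_completion) measurable
    also have "\<dots> = (LINT t|lborel. bump ((t - a) / d n) * g t) - (LINT t|lborel. bump ((t - b) / d n) * g t)"
      using int'[OF a d(2)] int'[OF b d(3)] by simp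
    finally have "d n * (LINT s|lborel. bump s * g (a + d n * s)) = d n * (LINT s|lborel. bump s * g (b + d n * s))"
      unfolding subst[OF a d(2)] subst[OF b d(3)] by simp
    then show ?thesis using d(1)[of n] by simp
  qed
  have "(LINT s::real|lborel. bump s * g a) = (LINT s::real|lborel. bump s * g b)"
    using conv[OF a d(2)] conv[OF b d(3)] unfolding eq by (rule LIMSEQ_unique)
  then have "(LINT s|lborel. bump (s::real)) * g a = (LINT s|lborel. bump (s::real)) * g b" by simp
  then have "g a = g b" using bump_integral_positive by simp
  then show ?thesis using a b by (simp add: g_def)
qed

section \<open>Conservation of mass\<close>

lemma bump_cutoff_tendsto:
  fixes w :: "'a::euclidean_space \<Rightarrow> real"
  assumes w: "integrable lebesgue w"
  shows "integrable lebesgue (\<lambda>x. w x * bump (x /\<^sub>R R))"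
    and "(\<lambda>n. LINT x|lebesgue. w x * bump (x /\<^sub>R (real n + 1))) \<longlonglongrightarrow> (LINT x|lebesgue. w x)"
proof -
  have m: "(\<lambda>x. w x * bump (x /\<^sub>R R)) \<in> borel_measurable lebesgue" for R
  proof (intro borel_measurable_times)
    show "(\<lambda>x::'a. bump (x /\<^sub>R R)) \<in> borel_measurable lebesgue"
      by (intro measurable_completion) simp
  qed (use w in auto)
  have le: "\<bar>w x * bump (x /\<^sub>R R)\<bar> \<le> \<bar>w x\<bar>" for x R
    using mult_left_mono[OF bump_le_1[of "x /\<^sub>R R"], of "\<bar>w x\<bar>"] by (simp add: abs_mult bump_nonneg)
  show "integrable lebesgue (\<lambda>x. w x * bump (x /\<^sub>R R))" for R
    by (rule Bochner_Integration.integrable_bound[OF w m]) (use le in simp)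
  show "(\<lambda>n. LINT x|lebesgue. w x * bump (x /\<^sub>R (real n + 1))) \<longlonglongrightarrow> (LINT x|lebesgue. w x)"
  proof (rule integral_dominated_convergence[OF _ m integrable_abs[OF w]])
    show "AE x in lebesgue. norm (w x * bump (x /\<^sub>R (real n + 1))) \<le> \<bar>w x\<bar>" for n
      using le by simp
    show "AE x in lebesgue. (\<lambda>n. w x * bump (x /\<^sub>R (real n + 1))) \<longlonglongrightarrow> w x"
    proof (rule AE_I2)
      fix x :: 'a
      have "(\<lambda>n. inverse (real n + 1)) \<longlonglongrightarrow> 0"
        using LIMSEQ_inverse_real_of_nat by (simp add: add.commute)
      from tendsto_scaleR[OF this tendsto_const[of x]]
      have lim: "(\<lambda>n. x /\<^sub>R (real n + 1)) \<longlonglongrightarrow> 0" by simp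
      have "isCont (bump :: 'a \<Rightarrow> real) 0"
        using continuous_bump[of "UNIV :: 'a set"] by (simp add: continuous_on_eq_continuous_at)
      from tendsto_mult[OF tendsto_const[of "w x"] isCont_tendsto_compose[OF this lim]]
      show "(\<lambda>n. w x * bump (x /\<^sub>R (real n + 1))) \<longlonglongrightarrow> w x" by (simp add: bump_0)
    qed
  qed (use w in auto)
qed

lemma tested_equation:
  fixes u :: "real \<Rightarrow> real ^ 'n \<Rightarrow> real"
  assumes weak: "weak_solution \<sigma> J \<phi> u0 u"
    and \<eta>: "\<And>k. Ck k \<eta>" and der: "\<And>t. (\<eta> has_real_derivative \<rho> t) (at t)"
    and zero: "\<And>t. t \<notin> {\<alpha>..\<beta>} \<Longrightarrow> \<eta> t = 0" and \<alpha>: "0 < \<alpha>" and R: "0 < R"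
  shows "(LINT t|lebesgue. indicator {0<..} t * (\<rho> t * (LINT x|lebesgue. u t x * bump (x /\<^sub>R R))))
    = (LINT t|lebesgue. indicator {0<..} t * (\<eta> t * bilinear_form J (\<lambda>x. \<phi> (u t x)) (\<lambda>x. bump (x /\<^sub>R R))))"
proof -
  let ?\<zeta> = "\<lambda>p :: (real ^ 'n) \<times> real. bump (fst p /\<^sub>R R) * \<eta> (snd p)"
  have "test_function ?\<zeta>" by (rule product_test_function[OF \<eta> zero \<alpha> R])
  then have "(LINT t:{0<..}|lebesgue. LINT x|lebesgue. u t x * deriv (\<lambda>s. ?\<zeta> (x, s)) t)
        - (LINT t:{0<..}|lebesgue. bilinear_form J (\<lambda>x. \<phi> (u t x)) (\<lambda>x. ?\<zeta> (x, t))) = 0"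
    using weak unfolding weak_solution_def by blast
  moreover have "deriv (\<lambda>s. ?\<zeta> (x, s)) t = bump (x /\<^sub>R R) * \<rho> t" for x t
    using DERIV_imp_deriv[OF DERIV_cmult[OF der]] by simp
  moreover have "(LINT x|lebesgue. u t x * (bump (x /\<^sub>R R) * \<rho> t)) = \<rho> t * (LINT x|lebesgue. u t x * bump (x /\<^sub>R R))" for t
    by (simp flip: mult.assoc)
  moreover have "bilinear_form J f (\<lambda>x. g x * c) = c * bilinear_form J f g" for f g c
  proof -
    have "(\<lambda>(x, y). (f x - f y) * (g x * c - g y * c) * J x y) = (\<lambda>p. c * (case p of (x, y) \<Rightarrow> (f x - f y) * (g x - g y) * J x y))"
      by (auto simp: fun_eq_iff algebra_simps)
    then show ?thesis by (simp add: bilinear_form_def)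
  qed
  ultimately show ?thesis by (simp add: set_lebesgue_integral_def)
qed

theorem theoremA1:
  fixes \<sigma> \<Lambda> :: real
    and J :: "real ^ 'n \<Rightarrow> real ^ 'n \<Rightarrow> real"
    and \<phi> :: "real \<Rightarrow> real"
    and u0 :: "real ^ 'n \<Rightarrow> real"
    and u :: "real \<Rightarrow> real ^ 'n \<Rightarrow> real"
  assumes "0 < \<sigma>" and "\<sigma> < 2" and "0 < \<Lambda>"
    and "admissible_kernel \<sigma> \<Lambda> J"
    and "admissible_nonlinearity \<phi>"
    and "integrable lebesgue u0"
    and "weak_solution \<sigma> J \<phi> u0 u"
    and "bounded_on_space_time u"
    and "\<exists>C>0. \<forall>s. \<bar>\<phi> s\<bar> \<le>
           (if critical_exponent TYPE('n) \<sigma> = 0 then C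
            else C * \<bar>s\<bar> powr critical_exponent TYPE('n) \<sigma>)"
  shows "\<forall>t>0. (LINT x|lebesgue. u t x) = (LINT x|lebesgue. u0 x)"
proof -
  define \<Phi> where "\<Phi> R v = bilinear_form J v (\<lambda>x. bump (x /\<^sub>R R))" for R v
  obtain D where D: "0 < D" and \<Phi>: "\<And>R a v q. 0 < R \<Longrightarrow> 0 \<le> a \<Longrightarrow> v \<in> borel_measurable lebesgue \<Longrightarrow>
      integrable lebesgue q \<Longrightarrow> (\<And>x. 0 \<le> q x) \<Longrightarrow> (\<And>x. \<bar>v x\<bar> \<le> a + q x) \<Longrightarrow>
      \<bar>\<Phi> R v\<bar> \<le> D * R powr (- \<sigma>) * (a * R ^ CARD('n) + (LINT x|lebesgue. q x))"
    using bilinear_form_bump_bound[OF assms(4,1,2,3)] unfolding \<Phi>_def by blast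
  note growth = nonlinearity_growth[OF assms(1,5,9)]
  obtain K where K: "0 \<le> K" "\<And>R s. 1 \<le> R \<Longrightarrow> R powr (- \<sigma>) * \<bar>\<phi> s\<bar> \<le> R powr (- real CARD('n)) + K * \<bar>s\<bar>"
    using growth[of 1] by auto
  have cL1: "continuous_L1 u" and L2: "L2_loc_Hdot \<sigma> (\<lambda>t x. \<phi> (u t x))"
    and init: "AE x in lebesgue. u 0 x = u0 x"
    using assms(7) unfolding weak_solution_def by blast+
  have ui: "integrable lebesgue (u t)" if "0 \<le> t" for t
    using cL1 that by (simp add: continuous_L1_def)
  define M where "M t = (LINT x|lebesgue. u t x)" for t
  define A where "A t = (LINT x|lebesgue. \<bar>u t x\<bar>)" for t
  have cM: "continuous_on {0..} M"
    unfolding M_def[abs_def] by (rule continuous_L1_functional[OF cL1 ui]) auto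
  have cA: "continuous_on {0..} A"
    unfolding A_def[abs_def] by (rule continuous_L1_functional[OF cL1]) (use ui in auto)
  have "AE t in lebesgue_on {0<..}. in_Hdot \<sigma> (\<lambda>x. \<phi> (u t x))"
    using L2 by (simp add: L2_loc_Hdot_def)
  then have vm: "AE t in lebesgue. 0 < t \<longrightarrow> (\<lambda>x. \<phi> (u t x)) \<in> borel_measurable lebesgue"
    by (auto simp: AE_restrict_space_iff in_Hdot_def elim!: eventually_mono)
  have const: "M a = M b" if a: "0 < a" and b: "0 < b" for a b
  proof (rule continuous_eq_from_mollified[OF cM a b])
    fix d :: real assume d: "0 < d" "d < a" "d < b"
    define \<rho> where "\<rho> t = bump ((t - a) / d) - bump ((t - b) / d)" for t :: real
    define \<alpha> where "\<alpha> = min a b - d"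
    define \<beta> where "\<beta> = max a b + d"
    have \<alpha>: "0 < \<alpha>" using d by (simp add: \<alpha>_def)
    obtain \<eta> where \<eta>: "\<And>k. Ck k \<eta>" and der: "\<And>t. (\<eta> has_real_derivative \<rho> t) (at t)"
      and zero: "\<And>t. t \<notin> {\<alpha>..\<beta>} \<Longrightarrow> \<eta> t = 0"
      using Ck_antiderivative_difference[OF d(1), of a b] unfolding \<rho>_def \<alpha>_def \<beta>_def by blast
    have \<rho>1: "\<bar>\<rho> t\<bar> \<le> 1" for t
      using bump_nonneg[of "(t - a) / d"] bump_nonneg[of "(t - b) / d"]
        bump_le_1[of "(t - a) / d"] bump_le_1[of "(t - b) / d"] by (simp add: \<rho>_def abs_le_iff)
    have \<rho>0: "\<rho> t = 0" if "t \<notin> {\<alpha>..\<beta>}" for t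
    proof -
      have "d \<le> \<bar>t - a\<bar>" "d \<le> \<bar>t - b\<bar>" using that by (auto simp: \<alpha>_def \<beta>_def)
      then have "bump ((t - a) / d) = 0" "bump ((t - b) / d) = 0"
        using d by (simp_all add: bump_eq_0_iff abs_divide)
      then show ?thesis by (simp add: \<rho>_def)
    qed
    have \<rho>c: "continuous_on S \<rho>" for S
      unfolding \<rho>_def by (intro continuous_intros continuous_on_compose2[OF continuous_bump[of UNIV]]) (use d in auto)
    obtain A0 where A0: "\<And>t. t \<in> {\<alpha>..\<beta>} \<Longrightarrow> \<bar>A t\<bar> \<le> A0"
    proof -
      have "compact (A ` {\<alpha>..\<beta>})"
        using \<alpha> by (intro compact_continuous_image continuous_on_subset[OF cA]) auto
      then show ?thesis using that by (metis compact_imp_bounded bounded_iff image_eqI real_norm_def)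
    qed
    obtain E where E: "\<And>t. t \<in> {\<alpha>..\<beta>} \<Longrightarrow> \<bar>\<eta> t\<bar> \<le> E"
    proof -
      have "compact (\<eta> ` {\<alpha>..\<beta>})"
        using \<eta>[of 0] by (intro compact_continuous_image) (auto intro: continuous_on_subset)
      then show ?thesis using that by (metis compact_imp_bounded bounded_iff image_eqI real_norm_def)
    qed
    define m where "m n t = (LINT x|lebesgue. u t x * bump (x /\<^sub>R (real n + 1)))" for n t
    have mA: "\<bar>m n t\<bar> \<le> A t" if "0 \<le> t" for n t
      unfolding m_def A_def
    proof (rule integral_abs_bound_integral[OF bump_cutoff_tendsto(1)[OF ui[OF that]]])
      show "integrable lebesgue (\<lambda>x. \<bar>u t x\<bar>)" using ui[OF that] by simp
      show "\<bar>u t x * bump (x /\<^sub>R (real n + 1))\<bar> \<le> \<bar>u t x\<bar>" for x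
        using mult_left_mono[OF bump_le_1[of "x /\<^sub>R (real n + 1)"], of "\<bar>u t x\<bar>"]
        by (simp add: abs_mult bump_nonneg)
    qed
    have mc: "continuous_on {0..} (m n)" for n
      unfolding m_def[abs_def]
    proof (rule continuous_L1_functional[OF cL1])
      show "integrable lebesgue (\<lambda>x. u t x * bump (x /\<^sub>R (real n + 1)))" if "0 \<le> t" for t
        by (rule bump_cutoff_tendsto(1)[OF ui[OF that]])
      show "\<bar>u t x * bump (x /\<^sub>R (real n + 1)) - u s x * bump (x /\<^sub>R (real n + 1))\<bar> \<le> \<bar>u t x - u s x\<bar>" for s t x
        using mult_left_mono[OF bump_le_1[of "x /\<^sub>R (real n + 1)"], of "\<bar>u t x - u s x\<bar>"]
        by (simp add: abs_mult bump_nonneg flip: left_diff_distrib)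
    qed
    \<comment> \<open>The support of \<open>\<eta>\<close> stays away from time 0, so everything happens on a compact interval of positive times.\<close>
    have window: "indicator {0<..} t * (\<rho> t * f t) = indicator {\<alpha>..\<beta>} t *\<^sub>R (\<rho> t * f t)" for f and t :: real
      using \<rho>0[of t] \<alpha> by (cases "t \<in> {\<alpha>..\<beta>}") auto
    have meas: "(\<lambda>t. indicator {0<..} t * (\<rho> t * f t)) \<in> borel_measurable lebesgue"
      if "continuous_on {0..} f" for f
    proof (unfold window, rule measurable_completion)
      have "continuous_on {\<alpha>..\<beta>} (\<lambda>t. \<rho> t * f t)"
        by (intro continuous_on_mult \<rho>c continuous_on_subset[OF that]) (use \<alpha> in auto)
      then have "(\<lambda>t. indicator {\<alpha>..\<beta>} t *\<^sub>R (\<rho> t * f t)) \<in> borel_measurable borel"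
        by (intro borel_measurable_continuous_on_indicator) auto
      then show "(\<lambda>t. indicator {\<alpha>..\<beta>} t *\<^sub>R (\<rho> t * f t)) \<in> borel_measurable lborel"
        by simp
    qed
    have wi: "integrable lebesgue (\<lambda>t. indicator {\<alpha>..\<beta>} t * c)" for c :: real
      by (intro integrable_mult_left integrable_real_indicator) (auto simp: emeasure_lborel_Icc_eq)
    let ?L = "\<lambda>n. LINT t|lebesgue. indicator {0<..} t * (\<rho> t * m n t)"
    have L1: "?L \<longlonglongrightarrow> (LINT t|lebesgue. indicator {0<..} t * (\<rho> t * M t))"
    proof (rule integral_dominated_convergence[OF meas[OF cM] meas[OF mc] wi[of A0]])
      show "AE t in lebesgue. norm (indicator {0<..} t * (\<rho> t * m n t)) \<le> indicator {\<alpha>..\<beta>} t * A0" for n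
      proof (rule AE_I2)
        fix t
        show "norm (indicator {0<..} t * (\<rho> t * m n t)) \<le> indicator {\<alpha>..\<beta>} t * A0"
        proof (cases "t \<in> {\<alpha>..\<beta>}")
          case True
          have "\<bar>\<rho> t\<bar> * \<bar>m n t\<bar> \<le> 1 * A0"
            using True \<alpha> \<rho>1[of t] A0[OF True] mA[of t n] by (intro mult_mono) auto
          with True show ?thesis unfolding window by (simp add: abs_mult)
        qed (simp add: window)
      qed
      show "AE t in lebesgue. (\<lambda>n. indicator {0<..} t * (\<rho> t * m n t)) \<longlonglongrightarrow> indicator {0<..} t * (\<rho> t * M t)"
      proof (rule AE_I2)
        fix t
        show "(\<lambda>n. indicator {0<..} t * (\<rho> t * m n t)) \<longlonglongrightarrow> indicator {0<..} t * (\<rho> t * M t)"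
        proof (cases "0 < t")
          case True
          then show ?thesis
            unfolding m_def M_def by (intro tendsto_mult tendsto_const bump_cutoff_tendsto(2) ui) simp
        qed simp
      qed
    qed
    have "(\<lambda>n. LINT t|lebesgue. indicator {0<..} t * (\<eta> t * \<Phi> (real n + 1) (\<lambda>x. \<phi> (u t x)))) \<longlonglongrightarrow> 0"
    proof (rule integral_dominated_null[OF wi[of "E * (D * (1 + K * A0))"]])
      show "AE t in lebesgue. (\<lambda>n. indicator {0<..} t * (\<eta> t * \<Phi> (real n + 1) (\<lambda>x. \<phi> (u t x)))) \<longlonglongrightarrow> 0"
        using vm
      proof eventually_elim
        case (elim t)
        show ?case
        proof (cases "0 < t")
          case True
          have "(\<lambda>n. \<Phi> (real n + 1) (\<lambda>x. \<phi> (u t x))) \<longlonglongrightarrow> 0"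
            by (rule forms_tendsto_zero[OF D \<Phi> growth assms(1)]) (use True elim ui in auto)
          from tendsto_mult_right_zero[OF tendsto_mult_right_zero[OF this]] show ?thesis .
        qed simp
      qed
      show "AE t in lebesgue. \<bar>indicator {0<..} t * (\<eta> t * \<Phi> (real n + 1) (\<lambda>x. \<phi> (u t x)))\<bar>
          \<le> indicator {\<alpha>..\<beta>} t * (E * (D * (1 + K * A0)))" for n
        using vm
      proof eventually_elim
        case (elim t)
        show ?case
        proof (cases "t \<in> {\<alpha>..\<beta>}")
          case True
          then have t: "0 < t" using \<alpha> by auto
          have "\<bar>\<Phi> (real n + 1) (\<lambda>x. \<phi> (u t x))\<bar> \<le> D * (1 + K * A t)"
            unfolding A_def by (rule forms_bounded[OF D \<Phi> K]) (use t elim ui in auto)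
          also have "\<dots> \<le> D * (1 + K * A0)"
            using A0[OF True] D K by (intro mult_left_mono add_left_mono) auto
          finally have "\<bar>\<eta> t\<bar> * \<bar>\<Phi> (real n + 1) (\<lambda>x. \<phi> (u t x))\<bar> \<le> E * (D * (1 + K * A0))"
            using E[OF True] by (intro mult_mono) auto
          with True t show ?thesis by (simp add: abs_mult)
        qed (simp add: zero)
      qed
    qed
    also have "(\<lambda>n. LINT t|lebesgue. indicator {0<..} t * (\<eta> t * \<Phi> (real n + 1) (\<lambda>x. \<phi> (u t x)))) = ?L"
      unfolding \<Phi>_def m_def by (rule ext, rule tested_equation[OF assms(7) \<eta> der zero \<alpha>, symmetric]) auto
    finally have "?L \<longlonglongrightarrow> 0" .
    with L1 have "(LINT t|lebesgue. indicator {0<..} t * (\<rho> t * M t)) = 0"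
      by (rule LIMSEQ_unique)
    then show "(LINT t|lebesgue. indicator {0<..} t * ((bump ((t - a) / d) - bump ((t - b) / d)) * M t)) = 0"
      by (simp add: \<rho>_def)
  qed
  have M0: "M 0 = (LINT x|lebesgue. u0 x)"
    unfolding M_def using init ui[of 0] assms(6) by (intro integral_cong_AE) auto
  show ?thesis
  proof (intro allI impI)
    fix t :: real assume t: "0 < t"
    have "((\<lambda>s. M s) \<longlongrightarrow> M 0) (at 0 within {0..})"
      using cM by (simp add: continuous_on_def)
    then have "(M \<longlongrightarrow> M 0) (at_right 0)"
      by (rule tendsto_within_subset) auto
    moreover have "\<forall>\<^sub>F s in at_right 0. M s = M t"
      using const[OF _ t] by (auto simp: eventually_at_filter)
    ultimately have "((\<lambda>_. M t) \<longlongrightarrow> M 0) (at_right (0::real))"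
      by (rule Lim_transform_eventually)
    then have "M t = M 0"
      using tendsto_unique[OF _ tendsto_const] trivial_limit_at_right_real by metis
    then show "(LINT x|lebesgue. u t x) = (LINT x|lebesgue. u0 x)"
      unfolding M0 by (simp add: M_def)
  qed
qed

end
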